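(* Let $np=d\log n$. If $d=d(n)\to\infty$ with $n$, then with high probability the stationary distribution $\pi$ of the simple random walk on $D_{n,p}$ satisfies $\pi_v\sim 1/n$ (for all $v\in V$).
   Context: $D_{n,p}$ is the random digraph with vertex set $V=[n]$ in which each directed edge $(i,j)$, $i\neq j$, is included independently with probability $p=p(n)$. The simple random walk moves at each step to a uniformly random out-neighbour of the current vertex; $\pi$ is its stationary distribution. $\log$ is the natural logarithm. "With high probability" means with probability tending to $1$ as $n\to\infty$, in the space of $D_{n,p}$. The $\sim$ is uniform over vertices: there is $\epsilon_n\to0$ such that with high probability $|n\pi_v-1|\le\epsilon_n$ for all $v\in V$ simultaneously. *)

theory Defs
  imports "HOL-Probability.Probability" "HOL-Probability.Product_PMF"
begin

text \<open>A digraph is given by its edge relation; the vertex set \<open>{1..n}\<close> is kept separately.\<close>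

definition possible_edges :: "nat \<Rightarrow> (nat \<times> nat) set" where
  "possible_edges n = {(i, j). i \<in> {1..n} \<and> j \<in> {1..n} \<and> i \<noteq> j}"

definition random_digraph :: "nat \<Rightarrow> real \<Rightarrow> nat rel pmf" where
  "random_digraph n p =
     map_pmf (\<lambda>f. {e. f e}) (Pi_pmf (possible_edges n) False (\<lambda>_. bernoulli_pmf p))"

text \<open>The out-neighbourhood of \<open>v\<close> is \<open>G `` {v}\<close>. For a vertex without out-neighbours
  the value of \<open>pmf_of_set\<close> is unspecified, so \<open>walk_step\<close> is only meaningful together
  with \<open>walk_well_defined\<close>.\<close>

definition walk_step :: "nat rel \<Rightarrow> nat \<Rightarrow> nat pmf" where
  "walk_step G v = pmf_of_set (G `` {v})"

definition walk_well_defined :: "nat set \<Rightarrow> nat rel \<Rightarrow> bool" where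
  "walk_well_defined V G \<longleftrightarrow> (\<forall>v\<in>V. G `` {v} \<noteq> {})"

definition stationary_distribution :: "nat set \<Rightarrow> nat rel \<Rightarrow> nat pmf \<Rightarrow> bool" where
  "stationary_distribution V G \<pi> \<longleftrightarrow> set_pmf \<pi> \<subseteq> V \<and> bind_pmf \<pi> (walk_step G) = \<pi>"

end

theory Submission
  imports Defs "HOL-Real_Asymp.Real_Asymp"
begin

text \<open>Write \<open>L = ln n\<close>. It suffices that with high probability, for some \<open>K = O(L)\<close> and all vertices
  \<open>s, v\<close>, the \<open>K\<close>-step probability from \<open>s\<close> to \<open>v\<close> is at most \<open>(1 + o(1)) / n\<close> and the
  \<open>(K + 1)\<close>-step probability is at least \<open>(1 - o(1)) / n\<close>: averaging over \<open>\<pi>\<close> gives both bounds on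
  \<open>\<pi>\<^sub>v\<close>, and positivity gives existence and uniqueness.

  Fix the target \<open>v\<close> and delete the edges into \<open>v\<close>. The \<open>k\<close>-step distribution \<open>z\<close> of the walk on
  the remaining digraph is independent of the deleted edges, so by a Chernoff bound the \<open>z\<close>-mass
  of the in-neighbourhood of \<open>v\<close> is \<open>p\<close> up to a relative error \<open>1 / sqrt d\<close> and an additive error
  \<open>O(L sqrt d max z)\<close>. Dividing by the out-degrees \<open>\<approx> d L\<close>, the probability of a first visit to \<open>v\<close> at
  time \<open>k + 1\<close> is \<open>(1 + O(1 / sqrt d)) / n + O(max z / sqrt d)\<close>. Later visits contribute a convolution of
  transition probabilities, which is negligible since \<open>k = O(L)\<close> while a single step has
  probability \<open>O(1 / (d L))\<close>. As \<open>z\<close> is dominated, up to a factor \<open>1 + o(1)\<close>, by the walk on the full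
  digraph, induction on \<open>k\<close> shows that the \<open>k\<close>-step probabilities decay geometrically down to
  \<open>(1 + o(1)) / n\<close>.\<close>

section \<open>Chernoff bounds for weighted Bernoulli sums\<close>

text \<open>For negative \<open>x = - y\<close> the lower Taylor polynomial of \<open>exp y\<close>
  suffices: its product with \<open>1 - y + y\<^sup>2\<close> is at least 1.\<close>

lemma exp_le_quadratic:
  fixes x :: real
  assumes "\<bar>x\<bar> \<le> 1"
  shows "exp x \<le> 1 + x + x\<^sup>2"
proof (cases "x \<ge> 0")
  case True
  then show ?thesis using assms exp_bound by auto
next
  case False
  define y where "y = - x"
  have y: "0 \<le> y" "y \<le> 1" using False assms by (auto simp: y_def)
  have "1 + y + y\<^sup>2 / 2 \<le> exp y" using exp_lower_Taylor_quadratic[OF y(1)] .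
  moreover have "1 \<le> (1 - y + y\<^sup>2) * (1 + y + y\<^sup>2 / 2)"
  proof -
    have "(1 - y + y\<^sup>2) * (1 + y + y\<^sup>2 / 2) = 1 + y\<^sup>2 * (1 + y + y\<^sup>2) / 2"
      by (simp add: field_simps power2_eq_square)
    then show ?thesis using y by simp
  qed
  moreover have "0 \<le> 1 - y + y\<^sup>2" using y by simp
  ultimately have "1 \<le> (1 - y + y\<^sup>2) * exp y"
    by (meson mult_left_mono order_trans)
  then have "exp (-y) \<le> 1 - y + y\<^sup>2"
    by (simp add: exp_minus field_simps)
  then show ?thesis by (simp add: y_def)
qed

text \<open>Since \<open>\<bar>l\<bar> * c e \<le> t\<close>, the second-order term of each factor
  is at most \<open>\<bar>l\<bar> * c e * t\<close>, which is linear in the weight. As the total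
  weight is at most 1, a single error \<open>\<bar>l\<bar> * p * t\<close> remains.\<close>

lemma bernoulli_sum_exp_moment:
  fixes c :: "'a \<Rightarrow> real"
  assumes B: "finite B" and c: "\<And>e. e \<in> B \<Longrightarrow> 0 \<le> c e" "sum c B \<le> 1"
    and p: "0 \<le> p" "p \<le> 1" and t: "0 \<le> t" "t \<le> 1" and l: "\<And>e. e \<in> B \<Longrightarrow> \<bar>l\<bar> * c e \<le> t"
  shows "measure_pmf.expectation (Pi_pmf B False (\<lambda>_. bernoulli_pmf p))
           (\<lambda>f. exp (l * ((\<Sum>e\<in>B. c e * of_bool (f e)) - p * sum c B))) \<le> exp (\<bar>l\<bar> * p * t)"
proof -
  let ?Q = "Pi_pmf B False (\<lambda>_. bernoulli_pmf p)"
  have 1: "exp (l * ((\<Sum>e\<in>B. c e * of_bool (f e)) - p * sum c B))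
        = exp (- l * p * sum c B) * (\<Prod>e\<in>B. exp (l * c e * of_bool (f e)))" for f
    using B by (simp add: exp_sum[symmetric] exp_add[symmetric] sum_distrib_left algebra_simps del: sum_mult_of_bool_eq)
  have 2: "measure_pmf.expectation (bernoulli_pmf p) (\<lambda>x. exp (l * c e * of_bool x))
      \<le> exp (p * (l * c e + \<bar>l\<bar> * c e * t))" if "e \<in> B" for e
  proof -
    have ab: "\<bar>l * c e\<bar> \<le> t" using l[OF that] c(1)[OF that] by (simp add: abs_mult)
    have "exp (l * c e) \<le> 1 + l * c e + (l * c e)\<^sup>2"
      using ab t by (intro exp_le_quadratic) auto
    also have "(l * c e)\<^sup>2 = \<bar>l * c e\<bar> * \<bar>l * c e\<bar>" by (simp add: power2_eq_square)
    also have "\<dots> \<le> \<bar>l * c e\<bar> * t" using ab by (intro mult_left_mono) auto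
    also have "\<bar>l * c e\<bar> = \<bar>l\<bar> * c e" using c(1)[OF that] by (simp add: abs_mult)
    finally have *: "exp (l * c e) - 1 \<le> l * c e + \<bar>l\<bar> * c e * t" by simp
    have "measure_pmf.expectation (bernoulli_pmf p) (\<lambda>x. exp (l * c e * of_bool x))
        = 1 + p * (exp (l * c e) - 1)"
      using p by (simp add: algebra_simps)
    also have "\<dots> \<le> 1 + p * (l * c e + \<bar>l\<bar> * c e * t)"
      using * p by (intro add_left_mono mult_left_mono) auto
    also have "\<dots> \<le> exp (p * (l * c e + \<bar>l\<bar> * c e * t))" by (rule exp_ge_add_one_self)
    finally show ?thesis .
  qed
  have "measure_pmf.expectation ?Q (\<lambda>f. exp (l * ((\<Sum>e\<in>B. c e * of_bool (f e)) - p * sum c B)))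
      = exp (- l * p * sum c B) * measure_pmf.expectation ?Q (\<lambda>f. \<Prod>e\<in>B. exp (l * c e * of_bool (f e)))"
    unfolding 1 by simp
  also have "measure_pmf.expectation ?Q (\<lambda>f. \<Prod>e\<in>B. exp (l * c e * of_bool (f e)))
     = (\<Prod>e\<in>B. measure_pmf.expectation (bernoulli_pmf p) (\<lambda>x. exp (l * c e * of_bool x)))"
    using B by (intro expectation_prod_Pi_pmf) (auto intro: integrable_measure_pmf_finite)
  also have "\<dots> \<le> (\<Prod>e\<in>B. exp (p * (l * c e + \<bar>l\<bar> * c e * t)))"
    using 2 by (intro prod_mono conjI Bochner_Integration.integral_nonneg) auto
  also have "\<dots> = exp (p * l * sum c B + p * \<bar>l\<bar> * t * sum c B)"
    using B by (simp add: exp_sum[symmetric] sum_distrib_left sum.distrib algebra_simps)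
  finally have "measure_pmf.expectation ?Q (\<lambda>f. exp (l * ((\<Sum>e\<in>B. c e * of_bool (f e)) - p * sum c B)))
     \<le> exp (- l * p * sum c B) * exp (p * l * sum c B + p * \<bar>l\<bar> * t * sum c B)"
    by simp
  also have "\<dots> = exp (\<bar>l\<bar> * p * t * sum c B)"
    by (simp add: exp_add[symmetric] algebra_simps)
  also have "\<dots> \<le> exp (\<bar>l\<bar> * p * t * 1)"
    using c p t by (intro exp_le_cancel_iff[THEN iffD2] mult_left_mono) auto
  finally show ?thesis by simp
qed

text \<open>Markov's inequality for the exponential moments of the centred sum and of its negative.
  The part \<open>p * t\<close> of the deviation cancels the moment bound, and
  \<open>M * a / t\<close> yields \<open>exp (- a)\<close>. If \<open>M = 0\<close>, all weights
  vanish and the event is empty.\<close>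

lemma bernoulli_sum_tail:
  fixes c :: "'a \<Rightarrow> real"
  assumes B: "finite B" and c: "\<And>e. e \<in> B \<Longrightarrow> 0 \<le> c e" "\<And>e. e \<in> B \<Longrightarrow> c e \<le> M" "sum c B \<le> 1"
    and p: "0 \<le> p" "p \<le> 1" and t: "0 < t" "t \<le> 1" and M: "0 \<le> M" and a: "0 \<le> a"
  shows "measure_pmf.prob (Pi_pmf B False (\<lambda>_. bernoulli_pmf p))
           {f. p * t + M * a / t < \<bar>(\<Sum>e\<in>B. c e * of_bool (f e)) - p * sum c B\<bar>} \<le> 2 * exp (- a)"
proof (cases "M = 0")
  case True
  then have "c e = 0" if "e \<in> B" for e using c that by (simp add: order_antisym)
  then have "{f. p * t + M * a / t < \<bar>(\<Sum>e\<in>B. c e * of_bool (f e)) - p * sum c B\<bar>} = {}"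
    using True p t by (auto simp: not_less)
  then show ?thesis by (metis (no_types, lifting) exp_ge_zero measure_empty mult_nonneg_nonneg zero_le_numeral)
next
  case False
  with M have M0: "0 < M" by simp
  let ?Q = "Pi_pmf B False (\<lambda>_. bernoulli_pmf p)"
  let ?Y = "\<lambda>f. (\<Sum>e\<in>B. c e * of_bool (f e)) - p * sum c B"
  have fin: "finite (set_pmf ?Q)"
    using B by (intro finite_subset[OF set_Pi_pmf_subset'] finite_PiE_dflt) auto
  have one_sided: "measure_pmf.prob ?Q {f. p * t + M * a / t < s * ?Y f} \<le> exp (- a)"
    if s: "\<bar>s\<bar> = 1" for s :: real
  proof -
    \<comment> \<open>The largest parameter for which \<open>c e \<le> M\<close> guarantees
      \<open>l * c e \<le> t\<close>.\<close>
    define l where "l = t / M"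
    have l: "0 < l" using M0 t by (simp add: l_def)
    have "measure_pmf.prob ?Q {f. p * t + M * a / t < s * ?Y f}
       \<le> measure_pmf.prob ?Q {f \<in> space ?Q. exp (l * (p * t + M * a / t)) \<le> exp (s * l * ?Y f)}"
      using l by (intro measure_pmf.finite_measure_mono) (auto simp: mult.assoc mult.left_commute[of s])
    also have "\<dots> \<le> measure_pmf.expectation ?Q (\<lambda>f. exp (s * l * ?Y f)) / exp (l * (p * t + M * a / t))"
      using fin by (intro integral_Markov_inequality_measure[where A="{}"]) (auto intro!: integrable_measure_pmf_finite)
    also have "\<dots> \<le> exp (\<bar>s * l\<bar> * p * t) / exp (l * (p * t + M * a / t))"
    proof (intro divide_right_mono bernoulli_sum_exp_moment B p)
      show "\<bar>s * l\<bar> * c e \<le> t" if "e \<in> B" for e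
        using c(2)[OF that] s l t M0 by (simp add: abs_mult l_def field_simps)
    qed (use c t in auto)
    also have "\<dots> = exp (- a)"
    proof -
      have "l * (M * a / t) = a" using M0 t by (simp add: l_def)
      then have "\<bar>s * l\<bar> * p * t - l * (p * t + M * a / t) = - a"
        using s l by (simp add: abs_mult algebra_simps)
      then show ?thesis by (simp add: exp_diff[symmetric])
    qed
    finally show ?thesis .
  qed
  have "measure_pmf.prob ?Q {f. p * t + M * a / t < \<bar>?Y f\<bar>}
     \<le> measure_pmf.prob ?Q ({f. p * t + M * a / t < 1 * ?Y f} \<union> {f. p * t + M * a / t < (-1) * ?Y f})"
    by (intro measure_pmf.finite_measure_mono) (auto simp: abs_if)
  also have "\<dots> \<le> measure_pmf.prob ?Q {f. p * t + M * a / t < 1 * ?Y f}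
      + measure_pmf.prob ?Q {f. p * t + M * a / t < (-1) * ?Y f}"
    by (rule measure_subadditive) auto
  also have "\<dots> \<le> exp (-a) + exp (-a)"
    by (intro add_mono one_sided) auto
  finally show ?thesis by simp
qed

section \<open>Weighted edge sums in the random digraph\<close>

lemma finite_possible_edges: "finite (possible_edges n)"
  by (rule finite_subset[of _ "{1..n} \<times> {1..n}"]) (auto simp: possible_edges_def)

lemma set_random_digraph:
  assumes "G \<in> set_pmf (random_digraph n p)"
  shows "G \<subseteq> possible_edges n"
  using assms set_Pi_pmf_subset[OF finite_possible_edges, of n False "\<lambda>_. bernoulli_pmf p"]
  by (auto simp: random_digraph_def)

text \<open>The weights may depend on the edges outside \<open>B\<close>. The product measure splits
  over \<open>B\<close> and its complement; once the outside part is fixed, the weights are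
  constants and \<open>bernoulli_sum_tail\<close> applies, so the bound survives averaging.\<close>

lemma random_digraph_weighted_sum_tail:
  fixes c :: "nat rel \<Rightarrow> nat \<times> nat \<Rightarrow> real"
  assumes B: "B \<subseteq> possible_edges n"
    and c: "\<And>H e. H \<subseteq> possible_edges n - B \<Longrightarrow> e \<in> B \<Longrightarrow> 0 \<le> c H e"
      "\<And>H e. H \<subseteq> possible_edges n - B \<Longrightarrow> e \<in> B \<Longrightarrow> c H e \<le> M H"
      "\<And>H. H \<subseteq> possible_edges n - B \<Longrightarrow> sum (c H) B \<le> 1"
    and M: "\<And>H. H \<subseteq> possible_edges n - B \<Longrightarrow> 0 \<le> M H"
    and p: "0 \<le> p" "p \<le> 1" and t: "0 < t" "t \<le> 1" and a: "0 \<le> a"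
  shows "measure_pmf.prob (random_digraph n p)
           {G. p * t + M (G - B) * a / t
                 < \<bar>(\<Sum>e\<in>B. c (G - B) e * of_bool (e \<in> G)) - p * sum (c (G - B)) B\<bar>} \<le> 2 * exp (- a)"
    (is "measure_pmf.prob _ ?S \<le> _")
proof -
  let ?A = "possible_edges n - B"
  let ?P = "\<lambda>A. Pi_pmf A False (\<lambda>_. bernoulli_pmf p)"
  have fin: "finite ?A" "finite B"
    using finite_possible_edges B finite_subset by auto
  have *: "random_digraph n p =
      bind_pmf (?P ?A) (\<lambda>f. map_pmf (\<lambda>g. {e. if e \<in> ?A then f e else g e}) (?P B))"
  proof -
    have "possible_edges n = ?A \<union> B" using B by auto
    then have "?P (possible_edges n) = ?P (?A \<union> B)" by simp
    also have "\<dots> = map_pmf (\<lambda>(f,g) x. if x \<in> ?A then f x else g x) (pair_pmf (?P ?A) (?P B))"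
      using fin by (intro Pi_pmf_union) auto
    finally show ?thesis
      by (simp add: random_digraph_def pair_pmf_def map_bind_pmf map_pmf_def bind_assoc_pmf bind_return_pmf)
  qed
  have inner: "measure_pmf.prob (map_pmf (\<lambda>g. {e. if e \<in> ?A then f e else g e}) (?P B)) ?S \<le> 2 * exp (- a)" for f
  proof -
    define H where "H = {e \<in> ?A. f e}"
    have H: "H \<subseteq> ?A" by (auto simp: H_def)
    have "measure_pmf.prob (map_pmf (\<lambda>g. {e. if e \<in> ?A then f e else g e}) (?P B)) ?S
        = measure_pmf.prob (?P B) ((\<lambda>g. {e. if e \<in> ?A then f e else g e}) -` ?S)"
      by simp
    also have "\<dots> = measure_pmf.prob (?P B) (((\<lambda>g. {e. if e \<in> ?A then f e else g e}) -` ?S) \<inter> set_pmf (?P B))"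
      by (simp add: measure_Int_set_pmf)
    also have "\<dots> \<le> measure_pmf.prob (?P B)
        {g. p * t + M H * a / t < \<bar>(\<Sum>e\<in>B. c H e * of_bool (g e)) - p * sum (c H) B\<bar>}"
    proof (intro measure_pmf.finite_measure_mono subsetI)
      fix g assume g: "g \<in> ((\<lambda>g. {e. if e \<in> ?A then f e else g e}) -` ?S) \<inter> set_pmf (?P B)"
      let ?G = "{e. if e \<in> ?A then f e else g e}"
      \<comment> \<open>Outside \<open>B\<close> the sample takes the default value of
        \<open>Pi_pmf\<close>, so removing \<open>B\<close> from the combined digraph leaves exactly
        the fixed part \<open>H\<close>.\<close>
      have "g e = False" if "e \<notin> B" for e
      proof -
        have "g \<in> {f. \<forall>x. x \<notin> B \<longrightarrow> f x = False}"
          using g set_Pi_pmf_subset[OF fin(2), of False "\<lambda>_. bernoulli_pmf p"] by blast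
        then show ?thesis using that by (cases e) auto
      qed
      then have "?G - B = H" by (auto simp: H_def split: if_splits)
      moreover have "(\<Sum>e\<in>B. c H e * of_bool (e \<in> ?G)) = (\<Sum>e\<in>B. c H e * of_bool (g e))"
        by (intro sum.cong) auto
      moreover have "?G \<in> ?S" using g by simp
      ultimately show "g \<in> {g. p * t + M H * a / t < \<bar>(\<Sum>e\<in>B. c H e * of_bool (g e)) - p * sum (c H) B\<bar>}"
        by (simp only: mem_Collect_eq)
    qed simp
    also have "\<dots> \<le> 2 * exp (- a)"
      using H by (intro bernoulli_sum_tail fin c M p t a)
    finally show ?thesis .
  qed
  have "ennreal (measure_pmf.prob (random_digraph n p) ?S) = emeasure (random_digraph n p) ?S"
    by (simp only: measure_pmf.emeasure_eq_measure)
  also have "\<dots> = (\<integral>\<^sup>+f. emeasure (map_pmf (\<lambda>g. {e. if e \<in> ?A then f e else g e}) (?P B)) ?S \<partial>?P ?A)"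
    unfolding * by (rule emeasure_bind_pmf)
  also have "\<dots> \<le> (\<integral>\<^sup>+f. ennreal (2 * exp (- a)) \<partial>?P ?A)"
  proof (rule nn_integral_mono)
    show "emeasure (map_pmf (\<lambda>g. {e. if e \<in> ?A then f e else g e}) (?P B)) ?S \<le> ennreal (2 * exp (- a))" for f
      using inner[of f] unfolding measure_pmf.emeasure_eq_measure by (rule ennreal_leI)
  qed
  also have "\<dots> = ennreal (2 * exp (- a))" by simp
  finally show ?thesis by (subst (asm) ennreal_le_iff) auto
qed

section \<open>Transition, taboo and first-visit probabilities\<close>

text \<open>A vertex \<open>u\<close> without out-neighbours gets the zero row, so the walk is
  killed there; mass can be lost but not created, also after edges have been deleted.\<close>

definition step_prob :: "'a rel \<Rightarrow> 'a \<Rightarrow> 'a \<Rightarrow> real" where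
  "step_prob G u w = of_bool ((u, w) \<in> G) / real (card (G `` {u}))"

primrec walk_prob :: "'a set \<Rightarrow> 'a rel \<Rightarrow> nat \<Rightarrow> 'a \<Rightarrow> 'a \<Rightarrow> real" where
  "walk_prob V G 0 s w = of_bool (s = w)"
| "walk_prob V G (Suc k) s w = (\<Sum>u\<in>V. walk_prob V G k s u * step_prob G u w)"

text \<open>The walk must avoid \<open>v\<close> at the times 1 to \<open>k\<close>. Time 0 is
  exempt, so that the start \<open>s = v\<close> is allowed.\<close>

primrec taboo_prob :: "'a set \<Rightarrow> 'a rel \<Rightarrow> 'a \<Rightarrow> nat \<Rightarrow> 'a \<Rightarrow> 'a \<Rightarrow> real" where
  "taboo_prob V G v 0 s w = of_bool (s = w)"
| "taboo_prob V G v (Suc k) s w =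
     (if w = v then 0 else \<Sum>u\<in>V. taboo_prob V G v k s u * step_prob G u w)"

text \<open>\<open>first_visit_prob V G v k s\<close> is the probability that the first visit to \<open>v\<close> after time \<open>0\<close>
  happens at time \<open>k + 1\<close>, not \<open>k\<close>; the start \<open>s = v\<close> is allowed and then gives first returns.\<close>

definition first_visit_prob :: "'a set \<Rightarrow> 'a rel \<Rightarrow> 'a \<Rightarrow> nat \<Rightarrow> 'a \<Rightarrow> real" where
  "first_visit_prob V G v k s = (\<Sum>u\<in>V. taboo_prob V G v k s u * step_prob G u v)"

definition delete_in_edges :: "'a \<Rightarrow> 'a rel \<Rightarrow> 'a rel" where
  "delete_in_edges v G = {(a, b) \<in> G. b \<noteq> v}"

lemma step_prob_nonneg: "0 \<le> step_prob G u w"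
  by (simp add: step_prob_def)

lemma walk_prob_nonneg: "0 \<le> walk_prob V G k s w"
  by (induction k arbitrary: w) (auto intro!: sum_nonneg mult_nonneg_nonneg step_prob_nonneg)

lemma taboo_prob_nonneg: "0 \<le> taboo_prob V G v k s w"
  by (induction k arbitrary: w) (auto intro!: sum_nonneg mult_nonneg_nonneg step_prob_nonneg)

lemma sum_step_prob:
  assumes "finite V" "G \<subseteq> V \<times> V"
  shows "(\<Sum>w\<in>V. step_prob G u w) = of_bool (G `` {u} \<noteq> {})"
proof -
  have sub: "G `` {u} \<subseteq> V" using assms by auto
  then have fin: "finite (G `` {u})" using assms finite_subset by auto
  have "(\<Sum>w\<in>V. step_prob G u w) = real (card (V \<inter> {w. (u, w) \<in> G})) / real (card (G `` {u}))"
    using assms by (simp add: step_prob_def sum_divide_distrib[symmetric])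
  also have "V \<inter> {w. (u, w) \<in> G} = G `` {u}" using sub by auto
  finally show ?thesis using fin by simp
qed

lemma sum_walk_prob_Suc:
  assumes "finite V" "G \<subseteq> V \<times> V"
  shows "(\<Sum>w\<in>V. walk_prob V G (Suc k) s w)
       = (\<Sum>u\<in>V. walk_prob V G k s u * of_bool (G `` {u} \<noteq> {}))"
proof -
  have "(\<Sum>w\<in>V. walk_prob V G (Suc k) s w) = (\<Sum>u\<in>V. \<Sum>w\<in>V. walk_prob V G k s u * step_prob G u w)"
    unfolding walk_prob.simps by (rule sum.swap)
  also have "\<dots> = (\<Sum>u\<in>V. walk_prob V G k s u * (\<Sum>w\<in>V. step_prob G u w))"
    by (simp only: sum_distrib_left)
  finally show ?thesis by (simp only: sum_step_prob[OF assms])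
qed

lemma sum_walk_prob_le_1:
  assumes "finite V" "G \<subseteq> V \<times> V"
  shows "(\<Sum>w\<in>V. walk_prob V G k s w) \<le> 1"
proof (induction k)
  case 0
  have "(\<Sum>w\<in>V. walk_prob V G 0 s w) = of_bool (s \<in> V)"
    using assms by (auto simp: of_bool_def)
  then show ?case by simp
next
  case (Suc k)
  have "(\<Sum>w\<in>V. walk_prob V G (Suc k) s w) \<le> (\<Sum>u\<in>V. walk_prob V G k s u)"
    unfolding sum_walk_prob_Suc[OF assms] by (intro sum_mono) (auto simp: walk_prob_nonneg)
  with Suc show ?case by simp
qed

lemma sum_walk_prob:
  assumes "finite V" "G \<subseteq> V \<times> V" "walk_well_defined V G" "s \<in> V"
  shows "(\<Sum>w\<in>V. walk_prob V G k s w) = 1"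
proof (induction k)
  case 0
  then show ?case using assms by (auto simp: of_bool_def)
next
  case (Suc k)
  have "(\<Sum>u\<in>V. walk_prob V G k s u * of_bool (G `` {u} \<noteq> {})) = (\<Sum>u\<in>V. walk_prob V G k s u)"
    using assms(3) by (intro sum.cong) (auto simp: walk_well_defined_def)
  with Suc show ?case unfolding sum_walk_prob_Suc[OF assms(1,2)] by simp
qed

text \<open>Chapman-Kolmogorov, by induction on the second leg.\<close>

lemma walk_prob_add:
  assumes "finite V" "w \<in> V"
  shows "walk_prob V G (j + k) s w = (\<Sum>u\<in>V. walk_prob V G j s u * walk_prob V G k u w)"
  using assms(2)
proof (induction k arbitrary: w)
  case 0
  have "(\<Sum>u\<in>V. walk_prob V G j s u * of_bool (u = w)) = (\<Sum>u\<in>V. if u = w then walk_prob V G j s u else 0)"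
    by (intro sum.cong) auto
  then show ?case using assms(1) 0 by simp
next
  case (Suc k)
  have "walk_prob V G (j + Suc k) s w
      = (\<Sum>x\<in>V. \<Sum>u\<in>V. walk_prob V G j s u * (walk_prob V G k u x * step_prob G x w))"
    by (simp add: Suc.IH sum_distrib_right mult.assoc)
  also have "\<dots> = (\<Sum>u\<in>V. \<Sum>x\<in>V. walk_prob V G j s u * (walk_prob V G k u x * step_prob G x w))"
    by (rule sum.swap)
  finally show ?case by (simp add: sum_distrib_left)
qed

text \<open>Classification by the time \<open>Suc j\<close> of the first visit to \<open>v\<close>,
  after which the walk restarts from \<open>v\<close> with \<open>k - Suc j\<close> steps left; the
  taboo term collects the walks without such a visit.\<close>

lemma walk_prob_decomp:
  assumes "finite V" "v \<in> V"
  shows "walk_prob V G k s w = taboo_prob V G v k s w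
     + (\<Sum>j<k. first_visit_prob V G v j s * walk_prob V G (k - Suc j) v w)"
proof (induction k arbitrary: w)
  case 0
  then show ?case by simp
next
  case (Suc k)
  have "walk_prob V G (Suc k) s w = (\<Sum>u\<in>V. taboo_prob V G v k s u * step_prob G u w)
     + (\<Sum>u\<in>V. \<Sum>j<k. first_visit_prob V G v j s * (walk_prob V G (k - Suc j) v u * step_prob G u w))"
    unfolding walk_prob.simps Suc.IH
    by (simp only: distrib_right sum.distrib sum_distrib_right mult.assoc)
  also have "(\<Sum>u\<in>V. \<Sum>j<k. first_visit_prob V G v j s * (walk_prob V G (k - Suc j) v u * step_prob G u w))
     = (\<Sum>j<k. first_visit_prob V G v j s * walk_prob V G (Suc (k - Suc j)) v w)"
    by (subst sum.swap) (simp add: sum_distrib_left)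
  also have "\<dots> = (\<Sum>j<k. first_visit_prob V G v j s * walk_prob V G (Suc k - Suc j) v w)"
    by (intro sum.cong) (auto simp: Suc_diff_Suc simp del: walk_prob.simps)
  \<comment> \<open>The last step either lands in \<open>v\<close>, which creates the summand
    \<open>j = k\<close>, or avoids it, which extends the taboo walk; for given \<open>w\<close> one
    of the two terms vanishes.\<close>
  also have "(\<Sum>u\<in>V. taboo_prob V G v k s u * step_prob G u w)
     = taboo_prob V G v (Suc k) s w + first_visit_prob V G v k s * walk_prob V G (Suc k - Suc k) v w"
    by (simp add: first_visit_prob_def)
  finally show ?case by simp
qed

lemma taboo_prob_le_walk_prob: "taboo_prob V G v k s w \<le> walk_prob V G k s w"
proof (induction k arbitrary: w)
  case (Suc k)
  then show ?case
    by (auto intro!: sum_nonneg sum_mono mult_nonneg_nonneg mult_right_mono step_prob_nonneg walk_prob_nonneg)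
qed simp

lemma first_visit_prob_le_walk_prob: "first_visit_prob V G v k s \<le> walk_prob V G (Suc k) s v"
  unfolding first_visit_prob_def walk_prob.simps
  by (intro sum_mono mult_right_mono step_prob_nonneg taboo_prob_le_walk_prob)

section \<open>Comparison with the digraph without the edges into a vertex\<close>

lemma delete_in_edges_Image: "delete_in_edges v G `` {u} = G `` {u} - {v}"
  by (auto simp: delete_in_edges_def)

lemma delete_in_edges_iff: "(u, w) \<in> delete_in_edges v G \<longleftrightarrow> (u, w) \<in> G \<and> w \<noteq> v"
  by (auto simp: delete_in_edges_def)

lemma step_prob_delete_in_edges:
  assumes "finite (G `` {u})" "w \<noteq> v"
  shows "step_prob G u w \<le> step_prob (delete_in_edges v G) u w"
proof (cases "(u, w) \<in> G")
  case True
  then have w: "w \<in> G `` {u} - {v}" using assms by auto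
  then have "0 < card (G `` {u} - {v})" using assms by (auto simp: card_gt_0_iff)
  moreover have "card (G `` {u} - {v}) \<le> card (G `` {u})" using assms by (intro card_mono) auto
  ultimately show ?thesis using True assms
    unfolding step_prob_def delete_in_edges_Image delete_in_edges_iff by (simp add: field_simps)
qed (simp add: step_prob_def)

lemma step_prob_delete_in_edges_upper:
  assumes fin: "finite (G `` {u})"
    and \<delta>: "0 \<le> \<delta>" "real (card (G `` {u})) \<le> (1 + \<delta>) * real (card (G `` {u} - {v}))"
  shows "step_prob (delete_in_edges v G) u w \<le> (1 + \<delta>) * step_prob G u w"
proof (cases "(u, w) \<in> G \<and> w \<noteq> v")
  case True
  then have w: "w \<in> G `` {u} - {v}" by auto
  then have *: "0 < card (G `` {u} - {v})" "0 < card (G `` {u})" using fin by (auto simp: card_gt_0_iff)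
  then show ?thesis using True \<delta>
    unfolding step_prob_def delete_in_edges_Image delete_in_edges_iff by (simp add: field_simps)
next
  case False
  then show ?thesis using \<delta> by (auto simp: step_prob_def delete_in_edges_iff)
qed

text \<open>A walk that avoids \<open>v\<close> uses only surviving edges, and each of them is at
  least as likely after the deletion because out-degrees shrink.\<close>

lemma taboo_prob_le_walk_prob_delete:
  assumes "\<And>u. finite (G `` {u})"
  shows "taboo_prob V G v k s w \<le> walk_prob V (delete_in_edges v G) k s w"
proof (induction k arbitrary: w)
  case (Suc k)
  show ?case
  proof (cases "w = v")
    case True
    then show ?thesis by (auto intro!: sum_nonneg mult_nonneg_nonneg step_prob_nonneg walk_prob_nonneg)
  next
    case False
    then show ?thesis using assms Suc
      by (auto intro!: sum_mono mult_mono step_prob_delete_in_edges step_prob_nonneg walk_prob_nonneg)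
  qed
qed simp

lemma walk_prob_delete_Suc_self: "walk_prob V (delete_in_edges v G) (Suc k) s v = 0"
  by (simp add: step_prob_def delete_in_edges_iff)

text \<open>The reverse comparison costs a factor \<open>1 + \<delta>\<close> per step, a bound for
  the ratio of the out-degrees before and after the deletion. At \<open>w = v\<close> both sides
  vanish from the first step on.\<close>

lemma walk_prob_delete_le_taboo_prob:
  assumes fin: "\<And>u. finite (G `` {u})" and \<delta>: "0 \<le> \<delta>"
    "\<And>u. u \<in> V \<Longrightarrow> real (card (G `` {u})) \<le> (1 + \<delta>) * real (card (G `` {u} - {v}))"
  shows "walk_prob V (delete_in_edges v G) k s w \<le> (1 + \<delta>) ^ k * taboo_prob V G v k s w"
proof (induction k arbitrary: w)
  case (Suc k)
  show ?case
  proof (cases "w = v")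
    case True
    then show ?thesis by (simp only: walk_prob_delete_Suc_self) simp
  next
    case False
    have "walk_prob V (delete_in_edges v G) (Suc k) s w
       \<le> (\<Sum>u\<in>V. ((1 + \<delta>) ^ k * taboo_prob V G v k s u) * ((1 + \<delta>) * step_prob G u w))"
      unfolding walk_prob.simps using \<delta>
      by (intro sum_mono mult_mono Suc step_prob_delete_in_edges_upper fin)
        (auto intro!: mult_nonneg_nonneg step_prob_nonneg taboo_prob_nonneg)
    also have "\<dots> = (1 + \<delta>) ^ Suc k * (\<Sum>u\<in>V. taboo_prob V G v k s u * step_prob G u w)"
      by (simp add: sum_distrib_left algebra_simps)
    finally show ?thesis using False by simp
  qed
qed simp

section \<open>Convergence of the walk and the stationary distribution\<close>

text \<open>The oscillation of \<open>s \<mapsto> walk_prob V G k s v\<close> shrinks by the factor \<open>1 - c\<close> every \<open>m\<close> steps.\<close>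

lemma walk_prob_convergent:
  assumes V: "finite V" "V \<noteq> {}" and G: "G \<subseteq> V \<times> V" "walk_well_defined V G"
    and c: "0 < c" "\<And>u w. u \<in> V \<Longrightarrow> w \<in> V \<Longrightarrow> c \<le> walk_prob V G m u w"
    and v: "v \<in> V"
  shows "\<exists>l. \<forall>s\<in>V. (\<lambda>k. walk_prob V G k s v) \<longlonglongrightarrow> l"
proof -
  define A where "A k = Max ((\<lambda>s. walk_prob V G k s v) ` V)" for k
  define B where "B k = Min ((\<lambda>s. walk_prob V G k s v) ` V)" for k
  have le_A: "walk_prob V G k s v \<le> A k" if "s \<in> V" for s k
    using V that by (auto simp: A_def)
  have B_le: "B k \<le> walk_prob V G k s v" if "s \<in> V" for s k
    using V that by (auto simp: B_def)
  have BA: "B k \<le> A k" for k using V le_A B_le by (meson ex_in_conv order_trans)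
  have A_ex: "\<exists>s\<in>V. A k = walk_prob V G k s v" for k
  proof -
    have "A k \<in> (\<lambda>s. walk_prob V G k s v) ` V" unfolding A_def using V by (intro Max_in) auto
    then show ?thesis by auto
  qed
  have B_ex: "\<exists>s\<in>V. B k = walk_prob V G k s v" for k
  proof -
    have "B k \<in> (\<lambda>s. walk_prob V G k s v) ` V" unfolding B_def using V by (intro Min_in) auto
    then show ?thesis by auto
  qed
  \<comment> \<open>Row sums are 1, so a value at time \<open>j + k\<close> is an average of values
    at time \<open>k\<close>; the sum is its deficit from the maximum \<open>A k\<close>.\<close>
  have step: "walk_prob V G (j + k) s v + (\<Sum>u\<in>V. walk_prob V G j s u * (A k - walk_prob V G k u v)) = A k"
    if s: "s \<in> V" for j k s
  proof -
    have "(\<Sum>u\<in>V. walk_prob V G j s u * (A k - walk_prob V G k u v))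
       = (\<Sum>u\<in>V. walk_prob V G j s u) * A k - walk_prob V G (j + k) s v"
      by (simp only: walk_prob_add[OF V(1) v] right_diff_distrib sum_subtractf sum_distrib_right)
    then show ?thesis using sum_walk_prob[OF V(1) G s] by simp
  qed
  have A_mono: "A (j + k) \<le> A k" for j k
  proof -
    obtain s where s: "s \<in> V" "A (j + k) = walk_prob V G (j + k) s v" using A_ex by blast
    have "0 \<le> (\<Sum>u\<in>V. walk_prob V G j s u * (A k - walk_prob V G k u v))"
      using le_A by (intro sum_nonneg mult_nonneg_nonneg walk_prob_nonneg) simp
    with step[OF s(1), of j k] s show ?thesis by simp
  qed
  have B_mono: "B k \<le> B (j + k)" for j k
  proof -
    obtain s where s: "s \<in> V" "B (j + k) = walk_prob V G (j + k) s v" using B_ex by blast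
    have "B k = (\<Sum>u\<in>V. walk_prob V G j s u * B k)"
      using sum_walk_prob[OF V(1) G s(1)] by (simp add: sum_distrib_right[symmetric])
    also have "\<dots> \<le> (\<Sum>u\<in>V. walk_prob V G j s u * walk_prob V G k u v)"
      using B_le by (intro sum_mono mult_left_mono walk_prob_nonneg)
    finally show ?thesis using s walk_prob_add[OF V(1) v] by simp
  qed
  \<comment> \<open>From any start the walk is at a minimising vertex \<open>u0\<close> after
    \<open>m\<close> steps with probability at least \<open>c\<close>, which costs the average
    \<open>c\<close> times the oscillation.\<close>
  have contract: "A (m + k) \<le> A k - c * (A k - B k)" for k
  proof -
    obtain s where s: "s \<in> V" "A (m + k) = walk_prob V G (m + k) s v" using A_ex by blast
    obtain u0 where u0: "u0 \<in> V" "B k = walk_prob V G k u0 v" using B_ex by blast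
    have "c * (A k - B k) \<le> walk_prob V G m s u0 * (A k - walk_prob V G k u0 v)"
      unfolding u0(2)[symmetric] using c s u0(1) BA by (intro mult_right_mono) auto
    also have "\<dots> \<le> (\<Sum>u\<in>V. walk_prob V G m s u * (A k - walk_prob V G k u v))"
      using V u0 le_A
      by (intro member_le_sum[of u0 V "\<lambda>u. walk_prob V G m s u * (A k - walk_prob V G k u v)"])
        (auto intro!: mult_nonneg_nonneg walk_prob_nonneg)
    finally show ?thesis using step[OF s(1), of m k] s by simp
  qed
  have decA: "decseq A" using A_mono[of 1] by (intro decseq_SucI) simp
  have incB: "incseq B" using B_mono[of _ 1] by (intro incseq_SucI) simp
  have "B 0 \<le> A k" for k using incseqD[OF incB, of 0 k] BA[of k] by simp
  then obtain a where a: "A \<longlonglongrightarrow> a" using decseq_convergent[OF decA] by metis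
  have "B k \<le> A 0" for k using decseqD[OF decA, of 0 k] BA[of k] by simp
  then obtain b where b: "B \<longlonglongrightarrow> b" using incseq_convergent[OF incB] by metis
  have "(\<lambda>k. A (m + k)) \<longlonglongrightarrow> a" using LIMSEQ_ignore_initial_segment[OF a, of m] by (simp add: add.commute)
  moreover have "(\<lambda>k. A k - c * (A k - B k)) \<longlonglongrightarrow> a - c * (a - b)" by (intro tendsto_intros a b)
  ultimately have "a \<le> a - c * (a - b)" using contract by (intro LIMSEQ_le) auto
  moreover have "b \<le> a" using a b BA by (intro LIMSEQ_le) auto
  ultimately have "a = b" using c by (auto simp: mult_le_0_iff)
  have "(\<lambda>k. walk_prob V G k s v) \<longlonglongrightarrow> a" if "s \<in> V" for s
  proof (rule tendsto_sandwich)
    show "B \<longlonglongrightarrow> a" using b \<open>a = b\<close> by simp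
    show "A \<longlonglongrightarrow> a" by (rule a)
  qed (simp_all add: le_A B_le that)
  then show ?thesis by auto
qed

text \<open>Well-definedness makes each \<open>pmf_of_set\<close> involved a genuine uniform
  distribution, which identifies \<open>walk_step\<close> with the matrix
  \<open>step_prob\<close>.\<close>

lemma pmf_bind_walk_step:
  assumes V: "finite V" and G: "G \<subseteq> V \<times> V" "walk_well_defined V G" and \<pi>: "set_pmf \<pi> \<subseteq> V"
  shows "pmf (bind_pmf \<pi> (walk_step G)) v = (\<Sum>u\<in>V. pmf \<pi> u * step_prob G u v)"
proof -
  have "pmf (bind_pmf \<pi> (walk_step G)) v = (\<Sum>u\<in>V. pmf \<pi> u * pmf (walk_step G u) v)"
    unfolding pmf_bind using V \<pi> by (subst integral_measure_pmf[of V]) auto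
  also have "\<dots> = (\<Sum>u\<in>V. pmf \<pi> u * step_prob G u v)"
  proof (intro sum.cong refl)
    fix u assume u: "u \<in> V"
    have "finite (G `` {u})" using V G(1) by (auto intro: finite_subset[of _ V])
    moreover have "G `` {u} \<noteq> {}" using u G(2) by (auto simp: walk_well_defined_def)
    ultimately show "pmf \<pi> u * pmf (walk_step G u) v = pmf \<pi> u * step_prob G u v"
      by (simp add: walk_step_def step_prob_def indicator_def)
  qed
  finally show ?thesis .
qed

lemma stationary_distribution_walk_prob:
  assumes V: "finite V" and G: "G \<subseteq> V \<times> V" "walk_well_defined V G"
    and \<pi>: "stationary_distribution V G \<pi>" and v: "v \<in> V"
  shows "pmf \<pi> v = (\<Sum>u\<in>V. pmf \<pi> u * walk_prob V G k u v)"
  using v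
proof (induction k arbitrary: v)
  case 0
  have "(\<Sum>u\<in>V. pmf \<pi> u * of_bool (u = v)) = (\<Sum>u\<in>V. if u = v then pmf \<pi> u else 0)"
    by (intro sum.cong) auto
  then show ?case using V 0 by simp
next
  case (Suc k)
  have "pmf \<pi> v = pmf (bind_pmf \<pi> (walk_step G)) v" using \<pi> by (simp add: stationary_distribution_def)
  also have "\<dots> = (\<Sum>w\<in>V. pmf \<pi> w * step_prob G w v)"
    using \<pi> by (intro pmf_bind_walk_step V G) (simp add: stationary_distribution_def)
  also have "\<dots> = (\<Sum>w\<in>V. \<Sum>u\<in>V. pmf \<pi> u * (walk_prob V G k u w * step_prob G w v))"
    by (intro sum.cong refl, subst Suc.IH) (auto simp: sum_distrib_right mult.assoc)
  also have "\<dots> = (\<Sum>u\<in>V. \<Sum>w\<in>V. pmf \<pi> u * (walk_prob V G k u w * step_prob G w v))"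
    by (rule sum.swap)
  finally show ?case by (simp add: sum_distrib_left)
qed

lemma sum_pmf_stationary_distribution:
  assumes "finite V" "stationary_distribution V G \<pi>"
  shows "(\<Sum>u\<in>V. pmf \<pi> u) = 1"
  using assms by (intro sum_pmf_eq_1) (auto simp: stationary_distribution_def)

text \<open>The limits \<open>l v\<close> of the transition probabilities form an invariant
  probability vector, which gives existence. Averaging the convergence over any stationary
  distribution shows that its weights are \<open>l v\<close>, which gives uniqueness.\<close>

lemma ex1_stationary_distribution:
  assumes V: "finite V" "V \<noteq> {}" and G: "G \<subseteq> V \<times> V" "walk_well_defined V G"
    and c: "0 < c" "\<And>u w. u \<in> V \<Longrightarrow> w \<in> V \<Longrightarrow> c \<le> walk_prob V G m u w"
  shows "\<exists>!\<pi>. stationary_distribution V G \<pi>"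
proof -
  have "\<forall>v. \<exists>l. v \<in> V \<longrightarrow> (\<forall>s\<in>V. (\<lambda>k. walk_prob V G k s v) \<longlonglongrightarrow> l)"
    using walk_prob_convergent[OF V G c] by blast
  then obtain l where l: "\<And>s v. s \<in> V \<Longrightarrow> v \<in> V \<Longrightarrow> (\<lambda>k. walk_prob V G k s v) \<longlonglongrightarrow> l v"
    by metis
  have uniq: "pmf \<pi> v = l v" if \<pi>: "stationary_distribution V G \<pi>" and v: "v \<in> V" for \<pi> v
  proof -
    have "(\<lambda>k. \<Sum>u\<in>V. pmf \<pi> u * walk_prob V G k u v) \<longlonglongrightarrow> (\<Sum>u\<in>V. pmf \<pi> u * l v)"
      using v by (intro tendsto_intros l)
    then have "(\<lambda>k. pmf \<pi> v) \<longlonglongrightarrow> (\<Sum>u\<in>V. pmf \<pi> u * l v)"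
      using stationary_distribution_walk_prob[OF V(1) G \<pi> v] by simp
    then have "pmf \<pi> v = (\<Sum>u\<in>V. pmf \<pi> u * l v)" by (simp add: LIMSEQ_const_iff)
    then show ?thesis
      using sum_pmf_stationary_distribution[OF V(1) \<pi>] by (simp add: sum_distrib_right[symmetric])
  qed
  obtain s where s: "s \<in> V" using V by auto
  have l0: "0 \<le> l v" if "v \<in> V" for v
    by (rule LIMSEQ_le_const[OF l[OF s that]]) (simp add: walk_prob_nonneg)
  have "(\<lambda>k. \<Sum>v\<in>V. walk_prob V G k s v) \<longlonglongrightarrow> (\<Sum>v\<in>V. l v)"
    using s by (intro tendsto_intros l)
  then have l1: "(\<Sum>v\<in>V. l v) = 1"
    using sum_walk_prob[OF V(1) G s] by (simp add: LIMSEQ_const_iff)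
  have lP: "l v = (\<Sum>u\<in>V. l u * step_prob G u v)" if v: "v \<in> V" for v
  proof -
    have "(\<lambda>k. walk_prob V G (Suc k) s v) \<longlonglongrightarrow> (\<Sum>u\<in>V. l u * step_prob G u v)"
      unfolding walk_prob.simps using s by (intro tendsto_intros l)
    then show ?thesis using LIMSEQ_Suc[OF l[OF s v]] LIMSEQ_unique by blast
  qed
  define f where "f v = (if v \<in> V then l v else 0)" for v
  define \<pi> where "\<pi> = embed_pmf f"
  have "(\<integral>\<^sup>+x. ennreal (f x) \<partial>count_space UNIV) = (\<Sum>x\<in>V. ennreal (f x))"
    using V by (intro nn_integral_count_space') (auto simp: f_def)
  also have "\<dots> = ennreal (\<Sum>x\<in>V. l x)" using l0 by (subst sum_ennreal[symmetric]) (auto simp: f_def)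
  finally have pmf_\<pi>: "pmf \<pi> v = f v" for v
    unfolding \<pi>_def using l1 l0 by (intro pmf_embed_pmf) (auto simp: f_def)
  have set\<pi>: "set_pmf \<pi> \<subseteq> V" by (auto simp: set_pmf_iff pmf_\<pi> f_def split: if_splits)
  have "stationary_distribution V G \<pi>"
    unfolding stationary_distribution_def
  proof (intro conjI set\<pi> pmf_eqI)
    fix v
    have "pmf (bind_pmf \<pi> (walk_step G)) v = (\<Sum>u\<in>V. l u * step_prob G u v)"
      unfolding pmf_bind_walk_step[OF V(1) G set\<pi>] by (intro sum.cong) (auto simp: pmf_\<pi> f_def)
    also have "\<dots> = f v"
    proof (cases "v \<in> V")
      case False
      then have "step_prob G u v = 0" for u using G by (auto simp: step_prob_def)
      then show ?thesis using False by (simp add: f_def)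
    qed (use lP in \<open>simp add: f_def\<close>)
    finally show "pmf (bind_pmf \<pi> (walk_step G)) v = pmf \<pi> v" by (simp add: pmf_\<pi>)
  qed
  moreover have "\<pi>1 = \<pi>2" if "stationary_distribution V G \<pi>1" "stationary_distribution V G \<pi>2" for \<pi>1 \<pi>2
  proof (rule pmf_eqI)
    fix v
    show "pmf \<pi>1 v = pmf \<pi>2 v"
    proof (cases "v \<in> V")
      case True
      then show ?thesis using uniq that by simp
    next
      case False
      then have "v \<notin> set_pmf \<pi>1" "v \<notin> set_pmf \<pi>2"
        using that by (auto simp: stationary_distribution_def)
      then show ?thesis by (simp add: set_pmf_iff)
    qed
  qed
  ultimately show ?thesis by blast
qed

section \<open>Deterministic estimates for a concentrated digraph\<close>

lemma sum_half_powers_le_1: "(\<Sum>j<k. (1/2::real) ^ Suc j) \<le> 1"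
proof -
  have "(\<Sum>j<k. (1/2::real) ^ Suc j) = 1 - (1/2) ^ k" by (induction k) auto
  then show ?thesis by simp
qed

lemma sum_half_powers_rev_le_1: "(\<Sum>j<k. (1/2::real) ^ (k - j)) \<le> 1"
proof -
  have "(\<Sum>j<k. (1/2::real) ^ (k - j)) = (\<Sum>j<k. (1/2::real) ^ Suc (k - Suc j))"
    by (intro sum.cong) (auto simp: Suc_diff_Suc simp del: power_Suc)
  also have "\<dots> = (\<Sum>j<k. (1/2::real) ^ Suc j)" by (rule sum.nat_diff_reindex)
  finally show ?thesis using sum_half_powers_le_1 by simp
qed

text \<open>\<open>L\<close> stands for \<open>ln n\<close> and \<open>\<eta>\<close> for \<open>1 / sqrt d\<close>; the slack \<open>4 * L / \<eta>\<close> makes each single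
  concentration event fail with probability at most \<open>2 / n ^ 4\<close>.\<close>

locale concentrated_digraph =
  fixes V :: "nat set" and G :: "nat rel" and N p d \<eta> L :: real and K :: nat
  assumes V: "finite V" and N_card: "N = real (card V)" and N: "N > 0"
    and G: "G \<subseteq> V \<times> V" "\<And>v. (v, v) \<notin> G"
    and p: "0 \<le> p" "p \<le> 1" "N * p = d * L"
    and \<eta>: "0 < \<eta>" "\<eta> \<le> 1 / 100" "d * \<eta>\<^sup>2 = 1"
    and L: "1 \<le> L" and K: "1 \<le> K" "real K \<le> 3 * L" "N \<le> 2 ^ K"
    and deg: "\<And>u. u \<in> V \<Longrightarrow> d * L * (1 - 6 * \<eta>) \<le> real (card (G `` {u}))"
      "\<And>u. u \<in> V \<Longrightarrow> real (card (G `` {u})) \<le> d * L * (1 + 6 * \<eta>)"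
    and conc: "\<And>s v k. s \<in> V \<Longrightarrow> v \<in> V \<Longrightarrow> k \<le> K \<Longrightarrow>
      \<bar>(\<Sum>u\<in>V - {v}. walk_prob V (delete_in_edges v G) k s u * of_bool ((u, v) \<in> G))
        - p * (\<Sum>u\<in>V - {v}. walk_prob V (delete_in_edges v G) k s u)\<bar>
      \<le> p * \<eta> + Max (walk_prob V (delete_in_edges v G) k s ` V) * (4 * L) / \<eta>"
begin

lemma d_eq: "d = 1 / \<eta>\<^sup>2"
  using \<eta> by (simp add: field_simps)

lemma d_ge: "d \<ge> 10000"
proof -
  have "\<eta>\<^sup>2 \<le> (1 / 100)\<^sup>2" using \<eta> by (intro power_mono) auto
  then have "1 / (1 / 100)\<^sup>2 \<le> 1 / \<eta>\<^sup>2" using \<eta> by (intro divide_left_mono) auto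
  then show ?thesis by (simp add: d_eq power2_eq_square)
qed

lemma dL_ge: "d * L \<ge> 10000"
  using mult_mono[OF d_ge L] d_ge by simp

lemma inverse_dL_le: "1 / (d * L) \<le> \<eta>\<^sup>2"
proof -
  have "1 / (d * L) = \<eta>\<^sup>2 / L" using \<eta> by (simp add: d_eq)
  also have "\<dots> \<le> \<eta>\<^sup>2 / 1" using L by (intro divide_left_mono) auto
  finally show ?thesis by simp
qed

lemma finite_out: "finite (G `` {u})"
  using G V by (auto intro: finite_subset[of _ V])

text \<open>The extra 1 pays for the possible loss of one out-edge when the edges into a vertex are
  deleted.\<close>

lemma deg_ge: "u \<in> V \<Longrightarrow> d * L / 2 + 1 \<le> real (card (G `` {u}))"
proof -
  assume "u \<in> V"
  have "d * L * (1 - 6 * \<eta>) \<ge> d * L * (94 / 100)" using \<eta> dL_ge by (intro mult_left_mono) auto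
  with deg(1)[OF \<open>u \<in> V\<close>] dL_ge show ?thesis by simp
qed

lemma well_defined: "walk_well_defined V G"
  unfolding walk_well_defined_def
proof
  fix u assume "u \<in> V"
  from deg_ge[OF this] dL_ge have "0 < real (card (G `` {u}))" by simp
  then show "G `` {u} \<noteq> {}" by (intro notI) simp
qed

text \<open>Deleting the edges into \<open>v\<close> raises a step probability by a factor at most \<open>1 + 2 / (d L)\<close>,
  and only \<open>O(L)\<close> steps are taken, so the total factor is \<open>exp (O (1 / d))\<close>.\<close>

lemma walk_prob_delete_bounds:
  assumes k: "k \<le> K"
  shows "walk_prob V (delete_in_edges v G) k s w \<le> (1 + \<eta>) * taboo_prob V G v k s w"
proof -
  define \<delta> where "\<delta> = 2 / (d * L)"
  have \<delta>: "0 \<le> \<delta>" using dL_ge by (simp add: \<delta>_def)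
  have card: "real (card (G `` {u})) \<le> (1 + \<delta>) * real (card (G `` {u} - {v}))" if u: "u \<in> V" for u
  proof -
    have "card (G `` {u}) \<le> card (G `` {u} - {v}) + 1"
      using card_Diff1_le[of "G `` {u}" v] finite_out[of u] by (cases "v \<in> G `` {u}") (auto simp: card_Diff_singleton_if)
    then have 1: "real (card (G `` {u})) \<le> real (card (G `` {u} - {v})) + 1" by linarith
    then have "d * L / 2 \<le> real (card (G `` {u} - {v}))" using deg_ge[OF u] by simp
    then have "\<delta> * (d * L / 2) \<le> \<delta> * real (card (G `` {u} - {v}))" using \<delta> by (rule mult_left_mono)
    moreover have "\<delta> * (d * L / 2) = 1" using dL_ge d_ge L unfolding \<delta>_def by (auto simp: field_simps)
    ultimately show ?thesis using 1 by (simp add: algebra_simps)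
  qed
  have "walk_prob V (delete_in_edges v G) k s w \<le> (1 + \<delta>) ^ k * taboo_prob V G v k s w"
    by (intro walk_prob_delete_le_taboo_prob finite_out \<delta> card)
  also have "\<dots> \<le> (1 + \<eta>) * taboo_prob V G v k s w"
  proof (intro mult_right_mono taboo_prob_nonneg)
    have "(1 + \<delta>) ^ k \<le> exp \<delta> ^ k" using \<delta> by (intro power_mono exp_ge_add_one_self) auto
    also have "\<dots> = exp (real k * \<delta>)" by (simp add: exp_of_nat_mult)
    \<comment> \<open>At most \<open>3 * L\<close> steps are taken and each costs
      \<open>\<delta> = 2 * \<eta>\<^sup>2 / L\<close>, so \<open>L\<close> cancels.\<close>
    also have "\<dots> \<le> exp (6 * \<eta>\<^sup>2)"
    proof -
      have "real k * \<delta> \<le> (3 * L) * \<delta>" using k K \<delta> by (intro mult_right_mono) auto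
      also have "\<dots> = 6 * \<eta>\<^sup>2" using L \<eta> by (simp add: \<delta>_def d_eq)
      finally show ?thesis by simp
    qed
    also have "\<dots> \<le> 1 + 2 * (6 * \<eta>\<^sup>2)"
    proof (rule real_exp_bound_lemma)
      have "\<eta>\<^sup>2 \<le> (1/100)\<^sup>2" using \<eta> by (intro power_mono) auto
      then show "6 * \<eta>\<^sup>2 \<le> 1 / 2" by (simp add: power2_eq_square)
    qed simp
    also have "\<dots> \<le> 1 + \<eta>" using \<eta> by (simp add: power2_eq_square)
    finally show "(1 + \<delta>) ^ k \<le> 1 + \<eta>" .
  qed
  finally show ?thesis .
qed

text \<open>Controls the maximum in the additive error of \<open>conc\<close> by the full walk, with
  the taboo probabilities as intermediary.\<close>

lemma Max_walk_prob_delete_le: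
  assumes k: "k \<le> K" and s: "s \<in> V" and M: "\<And>w. w \<in> V \<Longrightarrow> walk_prob V G k s w \<le> M"
  shows "Max (walk_prob V (delete_in_edges v G) k s ` V) \<le> (1 + \<eta>) * M"
proof -
  have "walk_prob V (delete_in_edges v G) k s w \<le> (1 + \<eta>) * M" if w: "w \<in> V" for w
  proof -
    have "walk_prob V (delete_in_edges v G) k s w \<le> (1 + \<eta>) * taboo_prob V G v k s w"
      by (rule walk_prob_delete_bounds[OF k])
    also have "\<dots> \<le> (1 + \<eta>) * M"
      using \<eta> M[OF w] taboo_prob_le_walk_prob[of V G v k s w] by (intro mult_left_mono) auto
    finally show ?thesis .
  qed
  then show ?thesis using V s by (subst Max_le_iff) auto
qed

lemma delete_sub: "delete_in_edges v G \<subseteq> V \<times> V"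
  using G by (auto simp: delete_in_edges_def)

section \<open>Upper bound for first-visit probabilities\<close>

text \<open>The summand \<open>u = v\<close> vanishes for lack of loops, which leaves the index set
  of \<open>conc\<close>.\<close>

lemma first_visit_prob_eq:
  assumes "v \<in> V"
  shows "first_visit_prob V G v k s
    = (\<Sum>u\<in>V - {v}. taboo_prob V G v k s u * (of_bool ((u, v) \<in> G) / real (card (G `` {u}))))"
  unfolding first_visit_prob_def step_prob_def using V G(2)[of v] assms
  by (subst sum.remove[of V v]) auto

text \<open>The taboo walk is dominated by the walk \<open>z\<close> on the reduced digraph, to
  which \<open>conc\<close> applies. Division by the lower bound \<open>D\<close> for the
  out-degrees turns \<open>p\<close> into \<open>1 / N\<close> and the error coefficient
  \<open>4 * L / \<eta>\<close> into \<open>4 * \<eta>\<close>, up to factors absorbed by the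
  constants 8 and 9.\<close>

lemma first_visit_prob_le:
  assumes k: "k \<le> K" and s: "s \<in> V" and v: "v \<in> V"
    and M: "\<And>w. w \<in> V \<Longrightarrow> walk_prob V G k s w \<le> M"
  shows "first_visit_prob V G v k s \<le> (1 + 8 * \<eta>) / N + 9 * \<eta> * M"
proof -
  define z where "z = walk_prob V (delete_in_edges v G) k s"
  define D where "D = d * L * (1 - 6 * \<eta>)"
  have D: "0 < D" using dL_ge \<eta> by (simp add: D_def)
  have M0: "0 \<le> M" by (rule order_trans[OF walk_prob_nonneg M[OF s]])
  have z: "0 \<le> z u" for u by (simp add: z_def walk_prob_nonneg)
  have "first_visit_prob V G v k s \<le> (\<Sum>u\<in>V - {v}. z u * (of_bool ((u, v) \<in> G) / D))"
    unfolding first_visit_prob_eq[OF v]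
  proof (intro sum_mono mult_mono)
    fix u assume u: "u \<in> V - {v}"
    show "taboo_prob V G v k s u \<le> z u"
      unfolding z_def by (intro taboo_prob_le_walk_prob_delete finite_out)
    show "of_bool ((u, v) \<in> G) / real (card (G `` {u})) \<le> of_bool ((u, v) \<in> G) / D"
      using deg(1)[of u] u D by (intro divide_left_mono) (auto simp: D_def)
  qed (auto simp: z)
  also have "\<dots> = (\<Sum>u\<in>V - {v}. z u * of_bool ((u, v) \<in> G)) / D"
    by (simp add: sum_divide_distrib del: sum_mult_of_bool_eq)
  also have "\<dots> \<le> (p * (1 + \<eta>) + ((1 + \<eta>) * M) * (4 * L) / \<eta>) / D"
  proof (rule divide_right_mono)
    have "(\<Sum>u\<in>V - {v}. z u) \<le> (\<Sum>u\<in>V. z u)" using V by (intro sum_mono2) (auto simp: z)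
    also have "\<dots> \<le> 1" unfolding z_def by (intro sum_walk_prob_le_1 V delete_sub)
    finally have "p * (\<Sum>u\<in>V - {v}. z u) \<le> p * 1" using p by (intro mult_left_mono)
    moreover have "Max (z ` V) * (4 * L) / \<eta> \<le> ((1 + \<eta>) * M) * (4 * L) / \<eta>"
      unfolding z_def using L \<eta> by (intro divide_right_mono mult_right_mono Max_walk_prob_delete_le k s M) auto
    ultimately show "(\<Sum>u\<in>V - {v}. z u * of_bool ((u, v) \<in> G)) \<le> p * (1 + \<eta>) + ((1 + \<eta>) * M) * (4 * L) / \<eta>"
      using conc[OF s v k] unfolding z_def[symmetric] by (simp add: algebra_simps abs_le_iff del: sum_mult_of_bool_eq)
  qed (use D in simp)
  also have "\<dots> = ((1 + \<eta>) / (1 - 6 * \<eta>)) / N + 4 * \<eta> * M * ((1 + \<eta>) / (1 - 6 * \<eta>))"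
  proof -
    have "p / (d * L) = 1 / N" using p(3) d_ge L N by (simp add: field_simps)
    then have "p * (1 + \<eta>) / D = (1 / N) * ((1 + \<eta>) / (1 - 6 * \<eta>))"
      unfolding D_def by (metis times_divide_times_eq)
    moreover have "((1 + \<eta>) * M) * (4 * L) / \<eta> / D = 4 * \<eta> * M * ((1 + \<eta>) / (1 - 6 * \<eta>))"
      using \<eta> L by (simp add: D_def d_eq field_simps power2_eq_square)
    ultimately show ?thesis by (simp add: add_divide_distrib)
  qed
  also have "\<dots> \<le> (1 + 8 * \<eta>) / N + 4 * \<eta> * M * (1 + 8 * \<eta>)"
  proof -
    \<comment> \<open>The next inequality has slack exactly
      \<open>\<eta> - 48 * \<eta>\<^sup>2\<close>.\<close>
    have "48 * \<eta>\<^sup>2 \<le> \<eta>" using \<eta> by (simp add: power2_eq_square)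
    then have "1 + \<eta> \<le> (1 + 8 * \<eta>) * (1 - 6 * \<eta>)" using \<eta> by (simp add: algebra_simps power2_eq_square)
    then have "(1 + \<eta>) / (1 - 6 * \<eta>) \<le> 1 + 8 * \<eta>" using \<eta> by (simp add: divide_le_eq)
    then show ?thesis using N \<eta> M0 by (intro add_mono divide_right_mono mult_left_mono) auto
  qed
  also have "4 * \<eta> * M * (1 + 8 * \<eta>) \<le> 4 * \<eta> * M * (9 / 4)"
    using \<eta> M0 by (intro mult_left_mono) auto
  finally show ?thesis by (simp add: mult_ac)
qed

section \<open>Geometric decay of the transition probabilities\<close>

text \<open>Here \<open>\<alpha> / 2\<close> is the one-step bound \<open>1 / (d * L / 2)\<close>,
  which starts the induction at \<open>k = 1\<close>.\<close>

definition \<alpha> :: real where "\<alpha> = 4 / (d * L)"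
text \<open>The level at which the recursion settles: 27 is 8 from the first-visit bound plus 19
  reserved for the errors proportional to \<open>\<beta>\<close>.\<close>

definition \<beta> :: real where "\<beta> = (1 + 27 * \<eta>) / N"

lemma alpha_nonneg: "0 \<le> \<alpha>"
  using dL_ge by (simp add: \<alpha>_def)

lemma beta_nonneg: "0 \<le> \<beta>"
  using \<eta> N by (simp add: \<beta>_def)

text \<open>The bound \<open>\<alpha> 2\<^sup>-\<^sup>k + \<beta>\<close> on the \<open>k\<close>-step probabilities reproduces itself: the last bracket is the
  contribution of the walks that visit the target before their final step.\<close>

lemma recursion_step:
  assumes k: "k \<le> K" and q: "0 \<le> q"
  shows "(1 + 8 * \<eta>) / N + 9 * \<eta> * (\<alpha> * q + \<beta>) + (real k * \<alpha>\<^sup>2 * (q / 2) + 2 * \<alpha> * \<beta> + real k * \<beta>\<^sup>2)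
    \<le> \<alpha> * (q / 2) + \<beta>"
proof -
  have kL: "real k \<le> 3 * L" using k K by simp
  have sq: "100 * \<eta>\<^sup>2 \<le> \<eta>" using \<eta> by (simp add: power2_eq_square)
  have "real k * \<alpha> \<le> (3 * L) * \<alpha>" using kL alpha_nonneg by (rule mult_right_mono)
  also have "\<dots> = 12 * \<eta>\<^sup>2" using L \<eta> by (simp add: \<alpha>_def) (simp add: d_eq)
  finally have k\<alpha>: "real k * \<alpha> \<le> 12 * \<eta>\<^sup>2" .
  have \<alpha>\<eta>: "\<alpha> \<le> 4 * \<eta>\<^sup>2" using inverse_dL_le by (simp add: \<alpha>_def)
  \<comment> \<open>As \<open>N * p = d * L\<close> and \<open>p \<le> 1\<close>, the vertex number
    dominates: \<open>L / N = p * \<eta>\<^sup>2 \<le> \<eta>\<^sup>2\<close>.\<close>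
  have k\<beta>: "real k * \<beta> \<le> 6 * \<eta>\<^sup>2"
  proof -
    have "\<beta> \<le> 2 / N" using \<eta> N by (simp add: \<beta>_def divide_right_mono)
    then have "real k * \<beta> \<le> (3 * L) * (2 / N)" using kL beta_nonneg L by (intro mult_mono) auto
    also have "\<dots> = 6 * (L / N)" by simp
    also have "L / N = p * \<eta>\<^sup>2" using p(3) N \<eta> by (simp add: d_eq field_simps)
    also have "\<dots> \<le> 1 * \<eta>\<^sup>2" using p by (intro mult_right_mono) auto
    finally show ?thesis by simp
  qed
  \<comment> \<open>The terms with \<open>q\<close> carry a factor of at most
    \<open>9 * \<eta> + 6 * \<eta>\<^sup>2\<close>, below \<open>1 / 2\<close>; this allows the
    halving per step.\<close>
  have 1: "9 * \<eta> * (\<alpha> * q) + real k * \<alpha>\<^sup>2 * (q / 2) \<le> \<alpha> * (q / 2)"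
  proof -
    have "9 * \<eta> * (\<alpha> * q) + real k * \<alpha>\<^sup>2 * (q / 2) = (\<alpha> * q) * (9 * \<eta> + real k * \<alpha> / 2)"
      by (simp add: algebra_simps power2_eq_square)
    also have "\<dots> \<le> (\<alpha> * q) * (1 / 2)"
      using k\<alpha> sq \<eta> alpha_nonneg q by (intro mult_left_mono) auto
    finally show ?thesis by simp
  qed
  \<comment> \<open>The errors without \<open>q\<close> are at most
    \<open>10 * \<eta> * \<beta>\<close>, which fits into the reserved
    \<open>19 * \<eta> / N\<close>.\<close>
  have 2: "(1 + 8 * \<eta>) / N + 9 * \<eta> * \<beta> + 2 * \<alpha> * \<beta> + real k * \<beta>\<^sup>2 \<le> \<beta>"
  proof -
    have "9 * \<eta> * \<beta> + 2 * \<alpha> * \<beta> + real k * \<beta>\<^sup>2 = \<beta> * (9 * \<eta> + 2 * \<alpha> + real k * \<beta>)"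
      by (simp add: algebra_simps power2_eq_square)
    also have "\<dots> \<le> \<beta> * (10 * \<eta>)"
      using k\<beta> \<alpha>\<eta> sq beta_nonneg \<eta> by (intro mult_left_mono) auto
    also have "\<dots> \<le> 19 * \<eta> / N"
    proof -
      have "(1 + 27 * \<eta>) * (10 * \<eta>) \<le> 19 * \<eta>" using sq \<eta> by (simp add: algebra_simps power2_eq_square)
      then show ?thesis using N by (simp add: \<beta>_def divide_right_mono)
    qed
    also have "(1 + 8 * \<eta>) / N + 19 * \<eta> / N = \<beta>" by (simp add: \<beta>_def add_divide_distrib[symmetric])
    finally show ?thesis by simp
  qed
  show ?thesis using 1 2 by (simp add: algebra_simps)
qed

lemma walk_prob_le_geometric:
  assumes "1 \<le> k" "k \<le> K" "s \<in> V" "v \<in> V"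
  shows "walk_prob V G k s v \<le> \<alpha> * (1 / 2) ^ k + \<beta>"
  using assms
proof (induction k arbitrary: s v rule: less_induct)
  case (less k)
  note s = less.prems(3) and v = less.prems(4)
  show ?case
  proof (cases "k = 1")
    case True
    have "walk_prob V G 1 s v = step_prob G s v" 
      using V s by (simp add: sum_of_bool_mult_eq)
    also have "\<dots> \<le> 1 / real (card (G `` {s}))" by (auto simp: step_prob_def)
    also have "\<dots> \<le> 1 / (d * L / 2)"
      using deg_ge[OF s] dL_ge by (intro divide_left_mono) auto
    also have "\<dots> = \<alpha> * (1 / 2) ^ 1" by (simp add: \<alpha>_def)
    finally show ?thesis using True beta_nonneg by simp
  next
    case False
    then obtain m where m: "k = Suc m" "1 \<le> m" using less.prems(1) by (cases k) auto
    have IH: "walk_prob V G j x y \<le> \<alpha> * (1 / 2) ^ j + \<beta>" if "1 \<le> j" "j \<le> m" "x \<in> V" "y \<in> V" for j x y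
      using less.IH[of j x y] less.prems(2) that m by simp
    \<comment> \<open>The target is the taboo vertex itself and \<open>k\<close> is positive, so the
      taboo term is 0. The summand \<open>j = m\<close> is a first visit at the very last
      step.\<close>
    have "walk_prob V G k s v = (\<Sum>j<Suc m. first_visit_prob V G v j s * walk_prob V G (m - j) v v)"
      by (subst walk_prob_decomp[OF V v]) (simp add: m)
    also have "\<dots> = first_visit_prob V G v m s + (\<Sum>j<m. first_visit_prob V G v j s * walk_prob V G (m - j) v v)"
      by simp
    \<comment> \<open>An earlier first visit is followed by a return from \<open>v\<close> to
      \<open>v\<close>. The two legs have lengths \<open>Suc j\<close> and \<open>m - j\<close>,
      both between 1 and \<open>m\<close>, so the induction hypothesis bounds each; the lengths add
      up to \<open>Suc m\<close>.\<close>
    also have "(\<Sum>j<m. first_visit_prob V G v j s * walk_prob V G (m - j) v v)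
       \<le> (\<Sum>j<m. (\<alpha> * (1 / 2) ^ Suc j + \<beta>) * (\<alpha> * (1 / 2) ^ (m - j) + \<beta>))"
      using s v alpha_nonneg beta_nonneg
      by (intro sum_mono mult_mono IH order_trans[OF first_visit_prob_le_walk_prob] walk_prob_nonneg add_nonneg_nonneg mult_nonneg_nonneg) auto
    also have "\<dots> = (\<Sum>j<m. \<alpha>\<^sup>2 * (1 / 2) ^ Suc m + (\<alpha> * \<beta> * (1 / 2) ^ Suc j + \<alpha> * \<beta> * (1 / 2) ^ (m - j)) + \<beta>\<^sup>2)"
    proof (intro sum.cong refl)
      fix j assume "j \<in> {..<m}"
      then have "(1 / 2 :: real) ^ Suc m = (1 / 2) ^ Suc j * (1 / 2) ^ (m - j)"
        by (simp add: power_add[symmetric])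
      then show "(\<alpha> * (1 / 2) ^ Suc j + \<beta>) * (\<alpha> * (1 / 2) ^ (m - j) + \<beta>)
        = \<alpha>\<^sup>2 * (1 / 2) ^ Suc m + (\<alpha> * \<beta> * (1 / 2) ^ Suc j + \<alpha> * \<beta> * (1 / 2) ^ (m - j)) + \<beta>\<^sup>2"
        by (simp add: algebra_simps power2_eq_square)
    qed
    also have "\<dots> = real m * \<alpha>\<^sup>2 * (1 / 2) ^ Suc m
        + \<alpha> * \<beta> * ((\<Sum>j<m. (1 / 2) ^ Suc j) + (\<Sum>j<m. (1 / 2) ^ (m - j))) + real m * \<beta>\<^sup>2"
      by (simp add: sum.distrib sum_distrib_left distrib_left)
    also have "\<dots> \<le> real m * \<alpha>\<^sup>2 * (1 / 2) ^ Suc m + \<alpha> * \<beta> * 2 + real m * \<beta>\<^sup>2"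
    proof -
      have "(\<Sum>j<m. (1 / 2) ^ Suc j) + (\<Sum>j<m. (1 / 2 :: real) ^ (m - j)) \<le> 2"
        using sum_half_powers_le_1[of m] sum_half_powers_rev_le_1[of m] by linarith
      then show ?thesis using alpha_nonneg beta_nonneg by (intro add_mono mult_left_mono order_refl) auto
    qed
    \<comment> \<open>This needs the bound at time \<open>m\<close> for all endpoints at once, hence
      the induction over all \<open>s\<close> and \<open>v\<close>.\<close>
    also have "first_visit_prob V G v m s \<le> (1 + 8 * \<eta>) / N + 9 * \<eta> * (\<alpha> * (1 / 2) ^ m + \<beta>)"
      using less.prems(2) m s v by (intro first_visit_prob_le IH) auto
    finally have "walk_prob V G k s v \<le> (1 + 8 * \<eta>) / N + 9 * \<eta> * (\<alpha> * (1 / 2) ^ m + \<beta>)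
        + (real m * \<alpha>\<^sup>2 * ((1 / 2) ^ m / 2) + 2 * \<alpha> * \<beta> + real m * \<beta>\<^sup>2)"
      by simp
    also have "\<dots> \<le> \<alpha> * ((1 / 2) ^ m / 2) + \<beta>"
      using less.prems(2) m by (intro recursion_step) auto
    finally show ?thesis by (simp add: m)
  qed
qed

text \<open>At time \<open>K\<close> the geometric term is at most \<open>\<eta> / N\<close> because
  \<open>2 ^ K \<ge> N\<close>.\<close>

lemma walk_prob_K_le:
  assumes "s \<in> V" "v \<in> V"
  shows "walk_prob V G K s v \<le> (1 + 28 * \<eta>) / N"
proof -
  have "\<alpha> * (1 / 2) ^ K \<le> \<eta> * (1 / N)"
  proof (rule mult_mono)
    have "\<alpha> \<le> 4 * \<eta>\<^sup>2" using inverse_dL_le by (simp add: \<alpha>_def)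
    also have "\<dots> \<le> \<eta>" using \<eta> by (simp add: power2_eq_square)
    finally show "\<alpha> \<le> \<eta>" .
    show "(1 / 2) ^ K \<le> 1 / N" using K N by (simp add: power_divide divide_left_mono)
  qed (use \<eta> in auto)
  with walk_prob_le_geometric[OF K(1) order_refl assms] show ?thesis
    by (simp add: \<beta>_def add_divide_distrib)
qed

section \<open>Lower bound for the transition probabilities\<close>

text \<open>At time \<open>K\<close> the walk on the reduced digraph has full mass and maximum at
  most \<open>2 / N\<close>. The additive error in \<open>conc\<close> is then at most
  \<open>8 * \<eta> * p\<close>, so the in-neighbourhood of \<open>v\<close> has mass at least
  \<open>p * (1 - 9 * \<eta>)\<close>, and first visits at time \<open>Suc K\<close> alone give the
  bound.\<close>

lemma walk_prob_Suc_K_ge: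
  assumes s: "s \<in> V" and v: "v \<in> V"
  shows "(1 - 28 * \<eta>) / N \<le> walk_prob V G (Suc K) s v"
proof -
  define z where "z = walk_prob V (delete_in_edges v G) K s"
  define D where "D = d * L * (1 + 6 * \<eta>)"
  have D: "0 < D" using dL_ge \<eta> by (simp add: D_def)
  have z: "0 \<le> z u" for u by (simp add: z_def walk_prob_nonneg)
  \<comment> \<open>No mass is killed, since every out-degree exceeds 1. No mass sits at
    \<open>v\<close>, even for \<open>s = v\<close>, since \<open>K \<ge> 1\<close>.\<close>
  have z1: "(\<Sum>u\<in>V - {v}. z u) = 1"
  proof -
    have "walk_well_defined V (delete_in_edges v G)"
      unfolding walk_well_defined_def delete_in_edges_Image
    proof
      fix u assume u: "u \<in> V"
      show "G `` {u} - {v} \<noteq> {}"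
      proof
        assume "G `` {u} - {v} = {}"
        then have "card (G `` {u}) \<le> card {v}" by (intro card_mono) auto
        then show False using deg_ge[OF u] dL_ge by simp
      qed
    qed
    then have "(\<Sum>u\<in>V. z u) = 1" unfolding z_def by (intro sum_walk_prob V delete_sub s)
    moreover obtain K' where "K = Suc K'" using K(1) by (cases K) auto
    then have "z v = 0" by (simp only: z_def walk_prob_delete_Suc_self)
    ultimately show ?thesis using V v by (simp add: sum.remove[of V v])
  qed
  have "(1 - 28 * \<eta>) / N \<le> (1 - 9 * \<eta>) / ((1 + \<eta>) * (1 + 6 * \<eta>)) / N"
  proof (rule divide_right_mono)
    have "(1 - 28 * \<eta>) * ((1 + \<eta>) * (1 + 6 * \<eta>)) \<le> 1 - 9 * \<eta>"
    proof -
      have "(1 - 28 * \<eta>) * ((1 + \<eta>) * (1 + 6 * \<eta>)) = 1 - 21 * \<eta> - 190 * \<eta>\<^sup>2 - 168 * \<eta>\<^sup>2 * \<eta>"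
        by (simp add: algebra_simps power2_eq_square)
      moreover have "0 \<le> 190 * \<eta>\<^sup>2" "0 \<le> 168 * \<eta>\<^sup>2 * \<eta>" using \<eta> by auto
      ultimately show ?thesis using \<eta> by linarith
    qed
    then show "1 - 28 * \<eta> \<le> (1 - 9 * \<eta>) / ((1 + \<eta>) * (1 + 6 * \<eta>))"
      using \<eta> by (subst pos_le_divide_eq) auto
  qed (use N in simp)
  also have "\<dots> = p * (1 - 9 * \<eta>) / ((1 + \<eta>) * D)"
  proof -
    have "p = d * L / N" using p(3) N by (simp add: field_simps)
    then show ?thesis using d_ge L N \<eta> by (simp add: D_def)
  qed
  also have "\<dots> \<le> (\<Sum>u\<in>V - {v}. z u * of_bool ((u, v) \<in> G)) / ((1 + \<eta>) * D)"
  proof (rule divide_right_mono)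
    have "Max (z ` V) \<le> (1 + \<eta>) * ((1 + 28 * \<eta>) / N)"
      unfolding z_def by (intro Max_walk_prob_delete_le walk_prob_K_le s order_refl)
    also have "\<dots> = (1 + \<eta>) * (1 + 28 * \<eta>) / N" by simp
    also have "\<dots> \<le> 2 / N"
    proof (rule divide_right_mono)
      have "(1 + \<eta>) * (1 + 28 * \<eta>) \<le> (1 + 1/100) * (1 + 28 * (1/100))"
        using \<eta> by (intro mult_mono) auto
      then show "(1 + \<eta>) * (1 + 28 * \<eta>) \<le> 2" by simp
    qed (use N in simp)
    finally have "Max (z ` V) * (4 * L) / \<eta> \<le> 2 / N * (4 * L) / \<eta>"
      using L \<eta> by (intro divide_right_mono mult_right_mono) auto
    also have "\<dots> = 8 * \<eta> * p"
    proof -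
      have "p = d * L / N" using p(3) N by (simp add: field_simps)
      then show ?thesis using N \<eta> by (simp add: d_eq field_simps power2_eq_square)
    qed
    finally show "p * (1 - 9 * \<eta>) \<le> (\<Sum>u\<in>V - {v}. z u * of_bool ((u, v) \<in> G))"
      using conc[OF s v order_refl] z1 unfolding z_def[symmetric]
      by (simp add: algebra_simps abs_le_iff del: sum_mult_of_bool_eq)
  qed (use D \<eta> in simp)
  also have "\<dots> = (\<Sum>u\<in>V - {v}. (z u / (1 + \<eta>)) * (of_bool ((u, v) \<in> G) / D))"
    by (simp add: sum_divide_distrib del: sum_mult_of_bool_eq)
  also have "\<dots> \<le> first_visit_prob V G v K s"
    unfolding first_visit_prob_eq[OF v]
  proof (intro sum_mono mult_mono)
    fix u assume u: "u \<in> V - {v}"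
    show "z u / (1 + \<eta>) \<le> taboo_prob V G v K s u"
      using walk_prob_delete_bounds[of K v s u] \<eta> by (simp add: z_def field_simps)
    show "of_bool ((u, v) \<in> G) / D \<le> of_bool ((u, v) \<in> G) / real (card (G `` {u}))"
      using deg(2)[of u] deg_ge[of u] dL_ge u D by (intro divide_left_mono) (auto simp: D_def intro!: mult_pos_pos)
  qed (use D \<eta> in \<open>auto simp: taboo_prob_nonneg\<close>)
  also have "\<dots> \<le> walk_prob V G (Suc K) s v" by (rule first_visit_prob_le_walk_prob)
  finally show ?thesis .
qed

section \<open>The stationary distribution of a concentrated digraph\<close>

theorem ex1_stationary: "\<exists>!\<pi>. stationary_distribution V G \<pi>"
proof (rule ex1_stationary_distribution[OF V _ G(1) well_defined])
  show "0 < (1 - 28 * \<eta>) / N" using \<eta> N by simp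
  show "V \<noteq> {}" using N N_card by auto
qed (rule walk_prob_Suc_K_ge)

theorem stationary_near_uniform:
  assumes \<pi>: "stationary_distribution V G \<pi>" and v: "v \<in> V"
  shows "\<bar>N * pmf \<pi> v - 1\<bar> \<le> 28 * \<eta>"
proof -
  note * = stationary_distribution_walk_prob[OF V G(1) well_defined \<pi> v]
  have sum_const: "(\<Sum>u\<in>V. pmf \<pi> u * c) = c" for c
    using sum_pmf_stationary_distribution[OF V \<pi>] by (simp add: sum_distrib_right[symmetric])
  have "pmf \<pi> v = (\<Sum>u\<in>V. pmf \<pi> u * walk_prob V G K u v)" by (rule *)
  also have "\<dots> \<le> (\<Sum>u\<in>V. pmf \<pi> u * ((1 + 28 * \<eta>) / N))"
    using walk_prob_K_le v by (intro sum_mono mult_left_mono) auto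
  finally have 1: "pmf \<pi> v \<le> (1 + 28 * \<eta>) / N" by (simp only: sum_const)
  have "(\<Sum>u\<in>V. pmf \<pi> u * ((1 - 28 * \<eta>) / N)) \<le> (\<Sum>u\<in>V. pmf \<pi> u * walk_prob V G (Suc K) u v)"
    using walk_prob_Suc_K_ge v by (intro sum_mono mult_left_mono) auto
  also have "\<dots> = pmf \<pi> v" by (rule *[symmetric])
  finally have 2: "(1 - 28 * \<eta>) / N \<le> pmf \<pi> v" by (simp only: sum_const)
  show ?thesis using 1 2 N by (simp add: abs_le_iff field_simps)
qed

end

section \<open>Probability of concentration\<close>

lemma exp_minus_4_ln: "0 < x \<Longrightarrow> exp (- (4 * ln x)) = 1 / x ^ 4" for x :: real
proof -
  assume "0 < x"
  then have "exp (4 * ln x) = x ^ 4"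
    using exp_of_nat_mult[of 4 "ln x"] by simp
  then show ?thesis by (simp add: exp_minus divide_inverse)
qed

text \<open>Constant weights \<open>1 / n\<close> on the \<open>n - 1\<close> possible edges out of
  \<open>u\<close> meet the normalisation of the tail bound; the deviation is then scaled back by
  \<open>n\<close>.\<close>

lemma out_degree_tail:
  assumes p: "0 \<le> p" "p \<le> 1" and t: "0 < t" "t \<le> 1" and a: "0 \<le> a" and u: "u \<in> {1..n}"
  shows "measure_pmf.prob (random_digraph n p)
      {G. real n * p * t + a / t < \<bar>real (card (G `` {u})) - p * (real n - 1)\<bar>} \<le> 2 * exp (- a)"
proof -
  define B where "B = {u} \<times> ({1..n} - {u})"
  have n: "0 < n" using u by simp
  have B: "B \<subseteq> possible_edges n" using u by (auto simp: B_def possible_edges_def)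
  have cardB: "real (card B) = real n - 1"
    using u by (simp add: B_def card_cartesian_product of_nat_diff)
  let ?S = "{G. p * t + (1 / real n) * a / t
       < \<bar>(\<Sum>e\<in>B. (1 / real n) * of_bool (e \<in> G)) - p * (\<Sum>e\<in>B. 1 / real n)\<bar>}"
  let ?T = "{G. real n * p * t + a / t < \<bar>real (card (G `` {u})) - p * (real n - 1)\<bar>}"
  have "measure_pmf.prob (random_digraph n p) (?T \<inter> set_pmf (random_digraph n p))
     \<le> measure_pmf.prob (random_digraph n p) ?S"
  proof (intro measure_pmf.finite_measure_mono subsetI)
    fix G assume G: "G \<in> ?T \<inter> set_pmf (random_digraph n p)"
    then have sub: "G \<subseteq> possible_edges n" using set_random_digraph by blast
    have "real n * (p * t + (1 / real n) * a / t) = real n * p * t + a / t"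
      using n by (simp add: algebra_simps)
    also have "\<dots> < \<bar>real (card (G `` {u})) - p * (real n - 1)\<bar>" using G by simp
    also have "card (G `` {u}) = card (B \<inter> G)"
    proof -
      have "B \<inter> G = Pair u ` (G `` {u})"
        using sub by (auto simp: B_def possible_edges_def)
      then show ?thesis by (simp add: card_image inj_on_def)
    qed
    also have "real (card (B \<inter> G)) - p * (real n - 1)
       = real n * ((\<Sum>e\<in>B. (1 / real n) * of_bool (e \<in> G)) - p * (\<Sum>e\<in>B. 1 / real n))"
    proof -
      have "finite B" by (simp add: B_def)
      then have hits: "(\<Sum>e\<in>B. (1 / real n) * of_bool (e \<in> G)) = real (card (B \<inter> G)) / real n"
        by (subst sum_distrib_left[symmetric]) simp
      have mean: "(\<Sum>e\<in>B. 1 / real n) = (real n - 1) / real n" using cardB by simp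
      show ?thesis unfolding hits mean using n by (simp add: field_simps)
    qed
    finally show "G \<in> ?S" using n by (simp only: abs_mult) simp
  qed simp
  also have "\<dots> \<le> 2 * exp (- a)"
    using random_digraph_weighted_sum_tail[of B n "\<lambda>_ _. 1 / real n" "\<lambda>_. 1 / real n", OF B _ _ _ _ p t a]
      cardB n by simp
  finally show ?thesis by (simp add: measure_Int_set_pmf)
qed

text \<open>With \<open>B\<close> the possible edges into \<open>v\<close>, the set
  \<open>G - B\<close> is \<open>delete_in_edges v G\<close>, so the walk probabilities are
  admissible weights: they depend only on edges outside \<open>B\<close>.\<close>

lemma walk_in_edges_tail:
  fixes n k :: nat
  defines "V \<equiv> {1..n}"
  assumes p: "0 \<le> p" "p \<le> 1" and t: "0 < t" "t \<le> 1" and a: "0 \<le> a" and v: "v \<in> V"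
  shows "measure_pmf.prob (random_digraph n p)
      {G. p * t + Max (walk_prob V (delete_in_edges v G) k s ` V) * a / t
        < \<bar>(\<Sum>u\<in>V - {v}. walk_prob V (delete_in_edges v G) k s u * of_bool ((u, v) \<in> G))
          - p * (\<Sum>u\<in>V - {v}. walk_prob V (delete_in_edges v G) k s u)\<bar>} \<le> 2 * exp (- a)"
    (is "measure_pmf.prob _ ?T \<le> _")
proof -
  define B where "B = (\<lambda>u. (u, v)) ` (V - {v})"
  have B: "B \<subseteq> possible_edges n" using v by (auto simp: B_def V_def possible_edges_def)
  define c where "c H e = walk_prob V H k s (fst e)" for H :: "nat rel" and e :: "nat \<times> nat"
  define M where "M H = Max (walk_prob V H k s ` V)" for H :: "nat rel"
  have V: "finite V" by (simp add: V_def)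
  have sumB: "(\<Sum>e\<in>B. f e) = (\<Sum>u\<in>V - {v}. f (u, v))" for f :: "nat \<times> nat \<Rightarrow> real"
    unfolding B_def by (subst sum.reindex) (auto simp: inj_on_def)
  let ?S = "{G. p * t + M (G - B) * a / t
       < \<bar>(\<Sum>e\<in>B. c (G - B) e * of_bool (e \<in> G)) - p * sum (c (G - B)) B\<bar>}"
  have "measure_pmf.prob (random_digraph n p) (?T \<inter> set_pmf (random_digraph n p))
     \<le> measure_pmf.prob (random_digraph n p) ?S"
  proof (intro measure_pmf.finite_measure_mono subsetI)
    fix G assume G: "G \<in> ?T \<inter> set_pmf (random_digraph n p)"
    then have sub: "G \<subseteq> possible_edges n" using set_random_digraph by blast
    then have "G - B = delete_in_edges v G"
      by (auto simp: B_def V_def possible_edges_def delete_in_edges_def)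
    then show "G \<in> ?S" using G by (simp add: sumB c_def M_def del: sum_mult_of_bool_eq)
  qed simp
  also have "\<dots> \<le> 2 * exp (- a)"
  proof (intro random_digraph_weighted_sum_tail B p t a)
    fix H assume H: "H \<subseteq> possible_edges n - B"
    then have HV: "H \<subseteq> V \<times> V" by (auto simp: possible_edges_def V_def)
    show "0 \<le> c H e" for e by (simp add: c_def walk_prob_nonneg)
    show "c H e \<le> M H" if "e \<in> B" for e
      unfolding c_def M_def using that V by (intro Max_ge) (auto simp: B_def)
    have "sum (c H) B \<le> (\<Sum>u\<in>V. walk_prob V H k s u)"
      unfolding sumB c_def using V by (auto intro!: sum_mono2 walk_prob_nonneg)
    also have "\<dots> \<le> 1" by (intro sum_walk_prob_le_1 V HV)
    finally show "sum (c H) B \<le> 1" .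
    have "walk_prob V H k s v \<le> M H" unfolding M_def using V v by (intro Max_ge) auto
    then show "0 \<le> M H" using walk_prob_nonneg[of V H k s v] by linarith
  qed
  finally show ?thesis by (simp add: measure_Int_set_pmf)
qed

text \<open>Union bound over \<open>n\<close> degree events and \<open>n * n * (K + 1)\<close> walk
  events. With \<open>t = \<eta>\<close> and \<open>a = 4 * L\<close> each has probability at most
  \<open>2 / n ^ 4\<close>, and \<open>K + 1 \<le> 3 * n\<close>.\<close>

lemma prob_concentrated_digraph:
  fixes n K :: nat and p d :: real
  defines "\<eta> \<equiv> 1 / sqrt d" and "L \<equiv> ln (real n)" and "V \<equiv> {1..n}"
  assumes p: "0 \<le> p" "p \<le> 1" "real n * p = d * L" and d: "10000 \<le> d" and n: "3 \<le> n"
    and K: "1 \<le> K" "real K \<le> 3 * L" "real n \<le> 2 ^ K"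
  shows "1 - 8 / real n \<le> measure_pmf.prob (random_digraph n p)
           {G. concentrated_digraph V G (real n) p d \<eta> L K}"
proof -
  let ?P = "random_digraph n p"
  define D where "D u = {G :: nat rel. real n * p * \<eta> + (4 * L) / \<eta>
      < \<bar>real (card (G `` {u})) - p * (real n - 1)\<bar>}" for u
  define C where "C = (\<lambda>(s, v, k). {G. p * \<eta> + Max (walk_prob V (delete_in_edges v G) k s ` V) * (4 * L) / \<eta>
        < \<bar>(\<Sum>u\<in>V - {v}. walk_prob V (delete_in_edges v G) k s u * of_bool ((u, v) \<in> G))
          - p * (\<Sum>u\<in>V - {v}. walk_prob V (delete_in_edges v G) k s u)\<bar>})"
  define I where "I = V \<times> V \<times> {..K}"
  define bad where "bad = (\<Union>u\<in>V. D u) \<union> (\<Union>i\<in>I. C i)"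
  have L: "1 \<le> L" unfolding L_def
    using exp_le n by (subst ln_ge_iff) auto
  have "100 \<le> sqrt d" using d by (intro real_le_rsqrt) simp
  then have \<eta>: "0 < \<eta>" "\<eta> \<le> 1 / 100" "d * \<eta>\<^sup>2 = 1"
    using d by (auto simp: \<eta>_def power_divide intro!: divide_left_mono)
  have fin: "finite V" "finite I" by (auto simp: V_def I_def)
  have tail: "2 * exp (- (4 * L)) = 2 / real n ^ 4"
    using exp_minus_4_ln[of "real n"] n by (simp add: L_def)
  have "measure_pmf.prob ?P bad \<le> measure_pmf.prob ?P (\<Union>u\<in>V. D u) + measure_pmf.prob ?P (\<Union>i\<in>I. C i)"
    unfolding bad_def by (rule measure_subadditive) auto
  also have "\<dots> \<le> (\<Sum>u\<in>V. measure_pmf.prob ?P (D u)) + (\<Sum>i\<in>I. measure_pmf.prob ?P (C i))"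
    using fin by (intro add_mono measure_UNION_le) auto
  also have "\<dots> \<le> (\<Sum>u\<in>V. 2 / real n ^ 4) + (\<Sum>i\<in>I. 2 / real n ^ 4)"
  proof (intro add_mono sum_mono)
    show "measure_pmf.prob ?P (D u) \<le> 2 / real n ^ 4" if "u \<in> V" for u
      unfolding D_def tail[symmetric] using p \<eta> L that by (intro out_degree_tail) (auto simp: V_def)
    show "measure_pmf.prob ?P (C i) \<le> 2 / real n ^ 4" if "i \<in> I" for i
    proof -
      obtain s v k where i: "i = (s, v, k)" by (cases i)
      show ?thesis
        unfolding C_def i prod.case tail[symmetric] V_def using p \<eta> L that
        by (intro walk_in_edges_tail) (auto simp: i I_def V_def)
    qed
  qed
  also have "\<dots> = (real n + real n * real n * (real K + 1)) * (2 / real n ^ 4)"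
    by (simp add: V_def I_def card_cartesian_product algebra_simps)
  also have "\<dots> \<le> (real n ^ 3 + real n * real n * (3 * real n)) * (2 / real n ^ 4)"
  proof (intro mult_right_mono add_mono mult_left_mono)
    show "real n \<le> real n ^ 3" using n by (intro self_le_power) auto
    have "L \<le> real n - 1" unfolding L_def using n by (intro ln_le_minus_one) auto
    then show "real K + 1 \<le> 3 * real n" using K by simp
  qed auto
  also have "\<dots> = 8 / real n"
    using n by (simp add: field_simps power3_eq_cube power4_eq_xxxx)
  finally have bad: "measure_pmf.prob ?P bad \<le> 8 / real n" .
  have "1 - 8 / real n \<le> 1 - measure_pmf.prob ?P bad" using bad by simp
  also have "\<dots> = measure_pmf.prob ?P (- bad)"
    using measure_pmf.prob_compl[of bad ?P] by (simp add: Compl_eq_Diff_UNIV)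
  also have "\<dots> = measure_pmf.prob ?P (- bad \<inter> set_pmf ?P)" by (simp add: measure_Int_set_pmf)
  also have "\<dots> \<le> measure_pmf.prob ?P {G. concentrated_digraph V G (real n) p d \<eta> L K}"
  proof (intro measure_pmf.finite_measure_mono subsetI CollectI)
    fix G assume G: "G \<in> - bad \<inter> set_pmf ?P"
    then have sub: "G \<subseteq> possible_edges n" using set_random_digraph by blast
    have notD: "G \<notin> D u" if "u \<in> V" for u using G that by (auto simp: bad_def)
    have notC: "G \<notin> C (s, v, k)" if "s \<in> V" "v \<in> V" "k \<le> K" for s v k
      using G that by (auto simp: bad_def I_def)
    \<comment> \<open>The 6 is 1 from \<open>n * p * \<eta>\<close>, 4 from
      \<open>4 * L / \<eta>\<close> with \<open>1 / \<eta> = d * \<eta>\<close>, and 1 for the shift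
      of the mean from \<open>n * p\<close> to \<open>p * (n - 1)\<close>, as
      \<open>p \<le> 1 \<le> \<eta> * (d * L)\<close>.\<close>
    have deg: "\<bar>real (card (G `` {u})) - d * L\<bar> \<le> 6 * \<eta> * (d * L)" if u: "u \<in> V" for u
    proof -
      have inv: "1 / \<eta> = d * \<eta>" using \<eta> by (simp add: field_simps power2_eq_square)
      have "\<bar>real (card (G `` {u})) - p * (real n - 1)\<bar> \<le> real n * p * \<eta> + (4 * L) / \<eta>"
        using notD[OF u] by (simp add: D_def not_less)
      also have "(4 * L) / \<eta> = 4 * L * (d * \<eta>)" by (simp add: inv[symmetric])
      finally have 1: "\<bar>real (card (G `` {u})) - p * (real n - 1)\<bar> \<le> 5 * \<eta> * (d * L)"
        using p(3) by (simp add: algebra_simps)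
      have "1 * 1 \<le> L * (d * \<eta>)"
        unfolding inv[symmetric] using L \<eta> by (intro mult_mono) auto
      then have "p \<le> \<eta> * (d * L)" using p by (simp add: algebra_simps)
      moreover have "p * (real n - 1) = d * L - p" using p(3) by (simp add: algebra_simps)
      ultimately show ?thesis using 1 p(1) by (simp add: abs_le_iff)
    qed
    show "concentrated_digraph V G (real n) p d \<eta> L K"
    proof
      fix u assume "u \<in> V"
      from deg[OF this] show "d * L * (1 - 6 * \<eta>) \<le> real (card (G `` {u}))"
        and "real (card (G `` {u})) \<le> d * L * (1 + 6 * \<eta>)"
        by (auto simp: algebra_simps abs_le_iff)
    next
      fix s v k assume "s \<in> V" "v \<in> V" "k \<le> K"
      from notC[OF this] show "\<bar>(\<Sum>u\<in>V - {v}. walk_prob V (delete_in_edges v G) k s u * of_bool ((u, v) \<in> G))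
        - p * (\<Sum>u\<in>V - {v}. walk_prob V (delete_in_edges v G) k s u)\<bar>
      \<le> p * \<eta> + Max (walk_prob V (delete_in_edges v G) k s ` V) * (4 * L) / \<eta>"
        by (simp add: C_def not_less del: sum_mult_of_bool_eq)
    qed (use sub fin n p \<eta> L K in \<open>auto simp: V_def possible_edges_def\<close>)
  qed simp
  finally show ?thesis .
qed

section \<open>Choice of the time scale and passage to the limit\<close>

text \<open>For \<open>K\<close> the binary logarithm rounded up, \<open>ln 2 \<ge> 2 / 3\<close>
  gives \<open>log 2 n \<le> 3 / 2 * ln n\<close>, and rounding costs at most
  \<open>1 \<le> ln n\<close>.\<close>

lemma two_power_cover:
  assumes "3 \<le> n"
  obtains K :: nat where "1 \<le> K" "real K \<le> 3 * ln (real n)" "real n \<le> 2 ^ K"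
proof
  define K where "K = nat \<lceil>log 2 (real n)\<rceil>"
  have L: "1 \<le> ln (real n)" using exp_le assms by (subst ln_ge_iff) auto
  have pos: "0 < log 2 (real n)" using assms by simp
  show "1 \<le> K" using pos by (simp add: K_def Suc_le_eq)
  have "log 2 (real n) \<le> real K" unfolding K_def by (rule real_nat_ceiling_ge)
  then show "real n \<le> 2 ^ K" using assms by (simp add: log_le_iff powr_realpow)
  have "real K \<le> log 2 (real n) + 1" using pos unfolding K_def by linarith
  also have "log 2 (real n) \<le> ln (real n) / (2 / 3)"
    unfolding log_def using L ln2_ge_two_thirds by (intro divide_left_mono) auto
  finally show "real K \<le> 3 * ln (real n)" using L by simp
qed

theorem mainTheorem4:
  fixes p d :: "nat \<Rightarrow> real"
  assumes "\<And>n. 0 \<le> p n \<and> p n \<le> 1"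
    and "\<And>n. n \<ge> 2 \<Longrightarrow> real n * p n = d n * ln (real n)"
    and "filterlim d at_top sequentially"
  shows "\<exists>\<epsilon> :: nat \<Rightarrow> real. \<epsilon> \<longlonglongrightarrow> 0 \<and>
    (\<lambda>n. measure_pmf.prob (random_digraph n (p n))
       {G. walk_well_defined {1..n} G \<and>
           (\<exists>!\<pi>. stationary_distribution {1..n} G \<pi>) \<and>
           (\<forall>\<pi>. stationary_distribution {1..n} G \<pi> \<longrightarrow>
              (\<forall>v\<in>{1..n}. \<bar>real n * pmf \<pi> v - 1\<bar> \<le> \<epsilon> n))}) \<longlonglongrightarrow> 1"
proof (intro exI[of _ "\<lambda>n. 28 * (1 / sqrt (d n))"] conjI)
  have "filterlim (\<lambda>n. sqrt (d n)) at_top sequentially"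
    by (rule filterlim_compose[OF sqrt_at_top assms(3)])
  then have "(\<lambda>n. 1 / sqrt (d n)) \<longlonglongrightarrow> 0"
    by (intro tendsto_divide_0[OF tendsto_const] filterlim_at_top_imp_at_infinity)
  then show "(\<lambda>n. 28 * (1 / sqrt (d n))) \<longlonglongrightarrow> 0"
    by (rule tendsto_mult_right_zero)
  let ?T = "\<lambda>n. {G. walk_well_defined {1..n} G \<and>
           (\<exists>!\<pi>. stationary_distribution {1..n} G \<pi>) \<and>
           (\<forall>\<pi>. stationary_distribution {1..n} G \<pi> \<longrightarrow>
              (\<forall>v\<in>{1..n}. \<bar>real n * pmf \<pi> v - 1\<bar> \<le> 28 * (1 / sqrt (d n))))}"
  \<comment> \<open>The threshold 10000 for \<open>d n\<close> ensures
    \<open>1 / sqrt (d n) \<le> 1 / 100\<close>, and \<open>n \<ge> 3\<close> ensures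
    \<open>ln n \<ge> 1\<close>.\<close>
  have "\<forall>\<^sub>F n in sequentially. 1 - 8 / real n \<le> measure_pmf.prob (random_digraph n (p n)) (?T n)"
    using filterlim_at_top[THEN iffD1, OF assms(3), rule_format, of 10000] eventually_ge_at_top[of 3]
  proof eventually_elim
    case (elim n)
    obtain K where K: "1 \<le> K" "real K \<le> 3 * ln (real n)" "real n \<le> 2 ^ K"
      using two_power_cover elim(2) by blast
    have "1 - 8 / real n \<le> measure_pmf.prob (random_digraph n (p n))
           {G. concentrated_digraph {1..n} G (real n) (p n) (d n) (1 / sqrt (d n)) (ln (real n)) K}"
      using assms(1,2)[of n] elim by (intro prob_concentrated_digraph K) auto
    also have "\<dots> \<le> measure_pmf.prob (random_digraph n (p n)) (?T n)"
    proof (intro measure_pmf.finite_measure_mono Collect_mono impI)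
      fix G assume "concentrated_digraph {1..n} G (real n) (p n) (d n) (1 / sqrt (d n)) (ln (real n)) K"
      then interpret concentrated_digraph "{1..n}" G "real n" "p n" "d n" "1 / sqrt (d n)" "ln (real n)" K .
      show "walk_well_defined {1..n} G \<and> (\<exists>!\<pi>. stationary_distribution {1..n} G \<pi>) \<and>
           (\<forall>\<pi>. stationary_distribution {1..n} G \<pi> \<longrightarrow>
              (\<forall>v\<in>{1..n}. \<bar>real n * pmf \<pi> v - 1\<bar> \<le> 28 * (1 / sqrt (d n))))"
        using well_defined ex1_stationary stationary_near_uniform by blast
    qed simp
    finally show ?case .
  qed
  then show "(\<lambda>n. measure_pmf.prob (random_digraph n (p n)) (?T n)) \<longlonglongrightarrow> 1"
  proof (rule tendsto_sandwich)
    show "(\<lambda>n. 1 - 8 / real n) \<longlonglongrightarrow> 1" by real_asymp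
    show "\<forall>\<^sub>F n in sequentially. measure_pmf.prob (random_digraph n (p n)) (?T n) \<le> 1" by simp
  qed simp
qed

end
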